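(* Let $n\ge 1$ be an integer and let $f:(0,\infty)\to\mathbb{R}$ be a differentiable convex function such that $f'$ is bounded from below and unbounded from above. Let $\phi:\mathbb{P}_n\to\mathbb{P}_n$ be a bijective map which satisfies $$H_f\left(\phi(A),\phi(B)\right)=H_f(A,B)\quad\text{for all } A,B\in\mathbb{P}_n.$$ Then there exists a unitary or antiunitary operator $U:\mathbb{C}^n\to\mathbb{C}^n$ such that $$\phi(A)=UAU^*\quad\text{for all } A\in\mathbb{P}_n.$$
   Context: $\mathbb{M}_n$ is the algebra of all $n\times n$ complex matrices, identified with linear operators on $\mathbb{C}^n$; $\mathbb{P}_n\subset\mathbb{M}_n$ is the set of all positive definite matrices. $\operatorname{Tr}$ is the usual trace. For a function $g$ on $(0,\infty)$ and $A\in\mathbb{P}_n$, $g(A)$ is defined by the functional calculus for self-adjoint matrices. For a differentiable convex function $f:(0,\infty)\to\mathbb{R}$ (whose derivative is automatically continuous), the Bregman $f$-divergence on $\mathbb{P}_n$ is $$H_f(X,Y)=\operatorname{Tr}\left(f(X)-f(Y)-f'(Y)(X-Y)\right),\quad X,Y\in\mathbb{P}_n.$$ An antiunitary operator is a bijective conjugate-linear operator $U$ on $\mathbb{C}^n$ with $\langle Ux,Uy\rangle=\langle y,x\rangle$ for all $x,y$; its adjoint $U^*$ (the conjugate-linear operator with $\langle Ux,y\rangle=\langle U^*y,x\rangle$) equals $U^{-1}$, so $UAU^*$ is again a linear operator. *)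

theory Defs
  imports "HOL-Analysis.Analysis"
begin

definition cinner :: "complex^'n \<Rightarrow> complex^'n \<Rightarrow> complex" where
  "cinner x y = (\<Sum>i\<in>UNIV. x $ i * cnj (y $ i))"

definition mat_adj :: "complex^'n^'n \<Rightarrow> complex^'n^'n" where
  "mat_adj A = (\<chi> i j. cnj (A $ j $ i))"

definition hermitian_mat :: "complex^'n^'n \<Rightarrow> bool" where
  "hermitian_mat A \<longleftrightarrow> mat_adj A = A"

text \<open>For hermitian \<open>A\<close> the number \<open>cinner (A *v x) x\<close> is real.\<close>

definition pos_def :: "(complex^'n^'n) set" where
  "pos_def = {A. hermitian_mat A \<and> (\<forall>x. x \<noteq> 0 \<longrightarrow> Re (cinner (A *v x) x) > 0)}"

definition unitary_mat :: "complex^'n^'n \<Rightarrow> bool" where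
  "unitary_mat U \<longleftrightarrow> mat_adj U ** U = mat 1 \<and> U ** mat_adj U = mat 1"

definition real_diag :: "real^'n \<Rightarrow> complex^'n^'n" where
  "real_diag d = (\<chi> i j. if i = j then complex_of_real (d $ i) else 0)"

text \<open>
  Functional calculus: \<open>g (U diag(d) U\<^sup>*) = U diag(g d) U\<^sup>*\<close> for unitary \<open>U\<close> and real \<open>d\<close>.
  Lemma \<open>spectral_fun_eq\<close> shows that the result does not depend on the diagonalization.
  Matrices that are not hermitian have no such diagonalization, and the value is unspecified.
\<close>

definition spectral_fun :: "(real \<Rightarrow> real) \<Rightarrow> complex^'n^'n \<Rightarrow> complex^'n^'n" where
  "spectral_fun g A = (THE B. \<exists>U d. unitary_mat U \<and> A = U ** real_diag d ** mat_adj U \<and>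
     B = U ** real_diag (\<chi> i. g (d $ i)) ** mat_adj U)"

lemma real_diag_intertwine:
  fixes W :: "complex^'n^'n"
  assumes "W ** real_diag d = real_diag e ** W"
  shows "W ** real_diag (\<chi> i. g (d $ i)) = real_diag (\<chi> i. g (e $ i)) ** W"
proof -
  have R: "(W ** real_diag d) $ i $ j = W $ i $ j * of_real (d $ j)"
    and L: "(real_diag d ** W) $ i $ j = of_real (d $ i) * W $ i $ j"
    for W :: "complex^'n^'n" and d i j
    by (simp_all add: matrix_matrix_mult_def real_diag_def if_distrib if_distribR cong: if_cong)
  have "W $ i $ j = 0 \<or> d $ j = e $ i" for i j
    using arg_cong[OF assms, of "\<lambda>M. M $ i $ j"] unfolding R L by auto
  then show ?thesis
    unfolding vec_eq_iff R L by (metis mult.commute mult_zero_left vec_lambda_beta)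
qed

lemma spectral_fun_eq:
  assumes U: "unitary_mat U"
  shows "spectral_fun g (U ** real_diag d ** mat_adj U) =
    U ** real_diag (\<chi> i. g (d $ i)) ** mat_adj U"
  unfolding spectral_fun_def
proof (rule the_equality)
  fix B
  assume "\<exists>V e. unitary_mat V \<and> U ** real_diag d ** mat_adj U = V ** real_diag e ** mat_adj V \<and>
     B = V ** real_diag (\<chi> i. g (e $ i)) ** mat_adj V"
  then obtain V e where V: "unitary_mat V"
    and eq: "U ** real_diag d ** mat_adj U = V ** real_diag e ** mat_adj V"
    and B: "B = V ** real_diag (\<chi> i. g (e $ i)) ** mat_adj V" by blast
  have c: "mat_adj U ** U = mat 1" "U ** mat_adj U = mat 1"
    "mat_adj V ** V = mat 1" "V ** mat_adj V = mat 1"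
    using U V by (auto simp: unitary_mat_def)
  have "mat_adj V ** U ** real_diag d = mat_adj V ** (U ** real_diag d ** mat_adj U) ** U"
    by (metis c(1) matrix_mul_assoc matrix_mul_rid)
  also have "\<dots> = real_diag e ** (mat_adj V ** U)"
    unfolding eq by (metis c(3) matrix_mul_assoc matrix_mul_lid)
  finally have i: "mat_adj V ** U ** real_diag (\<chi> i. g (d $ i)) =
      real_diag (\<chi> i. g (e $ i)) ** (mat_adj V ** U)"
    by (rule real_diag_intertwine)
  have "U ** real_diag (\<chi> i. g (d $ i)) ** mat_adj U =
      V ** (mat_adj V ** U ** real_diag (\<chi> i. g (d $ i))) ** mat_adj U"
    by (metis c(4) matrix_mul_assoc matrix_mul_lid)
  also have "\<dots> = B"
    unfolding i B by (metis c(2) matrix_mul_assoc matrix_mul_rid)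
  finally show "B = U ** real_diag (\<chi> i. g (d $ i)) ** mat_adj U" ..
qed (use U in blast)

definition bregman :: "(real \<Rightarrow> real) \<Rightarrow> complex^'n^'n \<Rightarrow> complex^'n^'n \<Rightarrow> complex" where
  "bregman f X Y =
     trace (spectral_fun f X - spectral_fun f Y - spectral_fun (deriv f) Y ** (X - Y))"

definition conj_linear :: "(complex^'n \<Rightarrow> complex^'n) \<Rightarrow> bool" where
  "conj_linear U \<longleftrightarrow> (\<forall>x y. U (x + y) = U x + U y) \<and> (\<forall>c x. U (c *s x) = cnj c *s U x)"

definition unitary_op :: "(complex^'n \<Rightarrow> complex^'n) \<Rightarrow> bool" where
  "unitary_op U \<longleftrightarrow> bij U \<and> Vector_Spaces.linear (*s) (*s) U \<and>
     (\<forall>x y. cinner (U x) (U y) = cinner x y)"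

definition antiunitary_op :: "(complex^'n \<Rightarrow> complex^'n) \<Rightarrow> bool" where
  "antiunitary_op U \<longleftrightarrow> bij U \<and> conj_linear U \<and>
     (\<forall>x y. cinner (U x) (U y) = cinner y x)"

definition op_adj :: "(complex^'n \<Rightarrow> complex^'n) \<Rightarrow> complex^'n \<Rightarrow> complex^'n" where
  "op_adj U = (THE V. Vector_Spaces.linear (*s) (*s) V \<and>
     (\<forall>x y. cinner (U x) y = cinner x (V y)))"

definition conj_op_adj :: "(complex^'n \<Rightarrow> complex^'n) \<Rightarrow> complex^'n \<Rightarrow> complex^'n" where
  "conj_op_adj U = (THE V. conj_linear V \<and> (\<forall>x y. cinner (U x) y = cinner (V y) x))"

end

theory Submission
  imports Defs
begin

text \<open>
  In \<open>H(B,X) - H(A,X) + H(A,Y) - H(B,Y) = Tr ((f'(X) - f'(Y)) (A - B))\<close> the first factors, over all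
  \<open>X\<close> and \<open>Y\<close>, separate the hermitian matrices, so \<open>\<phi>\<close> is affine. Positivity and surjectivity
  rule out a constant term, so \<open>\<phi>\<close> is the restriction of a real linear map \<open>L\<close> that is an
  automorphism of the positive semidefinite cone and hence sends each rank one projection \<open>P\<close> to
  \<open>m Q\<close> for some rank one projection \<open>Q\<close> and \<open>m > 0\<close>. Extend \<open>f'\<close> continuously to \<open>h\<close> on
  \<open>[0,\<infinity>)\<close>. By continuity of the functional calculus the identity holds for semidefinite arguments,
  and \<open>X = s P\<close>, \<open>Y = 0\<close> yields \<open>m (h(s m) - h(0)) = h(s) - h(0)\<close> for all \<open>s > 0\<close>. Since \<open>h\<close> is
  monotone and not constant, \<open>m = 1\<close>; the identity then says that \<open>L\<close> preserves \<open>Tr (P P')\<close> for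
  rank one projections, and Wigner's theorem applies.
\<close>

section \<open>Orthonormal bases and diagonal matrices\<close>

lemma cinner_simps:
  "cinner (x + y) z = cinner x z + cinner y z"
  "cinner x (y + z) = cinner x y + cinner x z"
  "cinner (x - y) z = cinner x z - cinner y z"
  "cinner x (y - z) = cinner x y - cinner x z"
  "cinner (c *s x) z = c * cinner x z"
  "cinner x (c *s z) = cnj c * cinner x z"
  "cinner (r *\<^sub>R x) z = r *\<^sub>R cinner x z"
  "cinner x (r *\<^sub>R z) = r *\<^sub>R cinner x z"
  "cinner 0 z = 0" "cinner x 0 = 0" "cinner (- x) z = - cinner x z" "cinner x (- z) = - cinner x z"
  by (simp_all add: cinner_def algebra_simps sum.distrib sum_subtractf sum_distrib_left
      scaleR_conv_of_real[where 'a=complex] sum_negf)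

lemma cinner_sum_left: "cinner (sum h I) z = (\<Sum>i\<in>I. cinner (h i) z)"
  by (induction I rule: infinite_finite_induct) (simp_all add: cinner_simps)

lemma cinner_sum_right: "cinner z (sum h I) = (\<Sum>i\<in>I. cinner z (h i))"
  by (induction I rule: infinite_finite_induct) (simp_all add: cinner_simps)

lemma cinner_commute: "cinner x y = cnj (cinner y x)"
  by (simp add: cinner_def mult.commute)

lemma Re_cinner: "Re (cinner x y) = inner x y"
  by (simp add: cinner_def inner_vec_def inner_complex_def)

lemma cinner_self: "cinner x x = of_real ((norm x)\<^sup>2)"
proof (rule complex_eqI)
  show "Re (cinner x x) = Re (of_real ((norm x)\<^sup>2))"
    by (simp add: Re_cinner power2_norm_eq_inner)
  show "Im (cinner x x) = Im (of_real ((norm x)\<^sup>2))"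
    by (simp add: cinner_def mult.commute)
qed

lemma cinner_eq_zero_iff [simp]: "cinner x x = 0 \<longleftrightarrow> x = 0"
  by (simp add: cinner_self)

lemma cinner_axis [simp]: "cinner x (axis i 1) = x $ i" "cinner (axis i 1) x = cnj (x $ i)"
  by (simp_all add: cinner_def axis_def if_distrib if_distribR cong: if_cong)

lemma cinner_adj: "cinner (A *v x) y = cinner x (mat_adj A *v y)"
proof -
  have "cinner (A *v x) y = (\<Sum>i\<in>UNIV. \<Sum>j\<in>UNIV. A $ i $ j * x $ j * cnj (y $ i))"
    by (simp add: cinner_def matrix_vector_mult_def sum_distrib_right)
  also have "\<dots> = (\<Sum>j\<in>UNIV. \<Sum>i\<in>UNIV. A $ i $ j * x $ j * cnj (y $ i))"
    by (rule sum.swap)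
  also have "\<dots> = cinner x (mat_adj A *v y)"
    by (simp add: cinner_def matrix_vector_mult_def mat_adj_def sum_distrib_left mult_ac)
  finally show ?thesis .
qed

lemma mat_adj_simps [simp]:
  "mat_adj (A + B) = mat_adj A + mat_adj B"
  "mat_adj (A - B) = mat_adj A - mat_adj B"
  "mat_adj (r *\<^sub>R A) = r *\<^sub>R mat_adj A"
  "mat_adj (mat_adj A) = A" "mat_adj 0 = 0" "mat_adj (mat 1) = mat 1" "mat_adj (- A) = - mat_adj A"
  by (simp_all add: mat_adj_def vec_eq_iff mat_def)

lemma hermitian_simps:
  "hermitian_mat A \<Longrightarrow> hermitian_mat B \<Longrightarrow> hermitian_mat (A + B)"
  "hermitian_mat A \<Longrightarrow> hermitian_mat B \<Longrightarrow> hermitian_mat (A - B)"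
  "hermitian_mat A \<Longrightarrow> hermitian_mat (r *\<^sub>R A)"
  "hermitian_mat 0" "hermitian_mat (mat 1)" "hermitian_mat A \<Longrightarrow> hermitian_mat (- A)"
  by (simp_all add: hermitian_mat_def)

lemma hermitian_sum: "(\<And>i. i \<in> I \<Longrightarrow> hermitian_mat (h i)) \<Longrightarrow> hermitian_mat (sum h I)"
  by (induction I rule: infinite_finite_induct) (simp_all add: hermitian_simps)

lemma hermitian_cinner: "hermitian_mat A \<Longrightarrow> cinner (A *v x) y = cinner x (A *v y)"
  by (simp add: cinner_adj hermitian_mat_def)

lemma scaleR_mv [simp]: "(r *\<^sub>R A) *v x = r *\<^sub>R (A *v (x :: complex^'n))"
  by (simp add: vec_eq_iff matrix_vector_mult_def scaleR_sum_right)

lemma mv_scaleR [simp]: "A *v (r *\<^sub>R x) = r *\<^sub>R (A *v (x :: complex^'n))"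
  by (simp add: vec_eq_iff matrix_vector_mult_def scaleR_sum_right)

lemma mv_scale [simp]: "A *v (c *s x) = c *s (A *v (x :: complex^'n))"
  by (simp add: vec_eq_iff matrix_vector_mult_def sum_distrib_left mult_ac)

lemma sum_mv: "sum h I *v x = (\<Sum>i\<in>I. h i *v (x :: complex^'n))"
  by (induction I rule: infinite_finite_induct) (simp_all add: matrix_vector_mult_add_rdistrib)

lemma mv_sum: "A *v sum h I = (\<Sum>i\<in>I. A *v (h i :: complex^'n))"
  by (induction I rule: infinite_finite_induct) (simp_all add: matrix_vector_right_distrib)

text \<open>The matrix \<open>v v\<^sup>*\<close>, which for a unit vector \<open>v\<close> is the
  orthogonal projection onto its span.\<close>

definition outer :: "complex^'n \<Rightarrow> complex^'n^'n" where
  "outer v = (\<chi> i j. v $ i * cnj (v $ j))"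

lemma outer_mv: "outer v *v x = cinner x v *s v"
  by (simp add: vec_eq_iff outer_def matrix_vector_mult_def cinner_def sum_distrib_left sum_distrib_right mult_ac)

lemma hermitian_outer [simp]: "hermitian_mat (outer v)"
  by (simp add: hermitian_mat_def mat_adj_def outer_def vec_eq_iff)

lemma outer_scaleR: "outer (r *\<^sub>R v) = (r\<^sup>2) *\<^sub>R outer v"
  by (simp add: outer_def vec_eq_iff power2_eq_square)

lemma outer_scale: "outer (c *s v) = ((norm c)\<^sup>2) *\<^sub>R outer v"
  by (simp add: outer_def vec_eq_iff scaleR_conv_of_real[where 'a=complex] complex_norm_square mult_ac
      del: of_real_power)

lemma trace_outer: "trace (outer v ** A) = cinner (A *v v) v"
proof -
  have "trace (outer v ** A) = (\<Sum>i\<in>UNIV. \<Sum>k\<in>UNIV. v $ i * cnj (v $ k) * A $ k $ i)"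
    by (simp add: trace_def matrix_matrix_mult_def outer_def)
  also have "\<dots> = (\<Sum>k\<in>UNIV. \<Sum>i\<in>UNIV. v $ i * cnj (v $ k) * A $ k $ i)"
    by (rule sum.swap)
  also have "\<dots> = cinner (A *v v) v"
    by (simp add: cinner_def matrix_vector_mult_def sum_distrib_left sum_distrib_right mult_ac)
  finally show ?thesis .
qed

lemma trace_scaleR: "trace (r *\<^sub>R A) = r *\<^sub>R trace (A :: complex^'n^'n)"
  by (simp add: trace_def scaleR_sum_right)

lemma mm_scaleR: "(r *\<^sub>R A) ** B = r *\<^sub>R (A ** (B :: complex^'n^'n))" "A ** (r *\<^sub>R B) = r *\<^sub>R (A ** B)"
  by (simp_all add: vec_eq_iff matrix_matrix_mult_def scaleR_sum_right)

lemma mm_diff: "(A - B) ** C = A ** C - B ** (C :: complex^'n^'n)" "A ** (B - C) = A ** B - A ** C"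
  by (simp_all add: vec_eq_iff matrix_matrix_mult_def sum_subtractf algebra_simps)

text \<open>The family is indexed by the coordinate type, so orthonormality alone makes it a
  basis.\<close>

definition onb :: "('n \<Rightarrow> complex^'n) \<Rightarrow> bool" where
  "onb u \<longleftrightarrow> (\<forall>i j. cinner (u i) (u j) = (if i = j then 1 else 0))"

text \<open>A spectral decomposition as a weighted sum of projections; by
  \<open>columns_mat_diag\<close> it is the conjugate of a \<open>real_diag\<close> by the matrix
  with columns \<open>u\<close>.\<close>

definition diag_in :: "('n \<Rightarrow> complex^'n) \<Rightarrow> ('n \<Rightarrow> real) \<Rightarrow> complex^'n^'n" where
  "diag_in u d = (\<Sum>i\<in>UNIV. d i *\<^sub>R outer (u i))"

definition columns_mat :: "('n \<Rightarrow> complex^'n) \<Rightarrow> complex^'n^'n" where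
  "columns_mat u = (\<chi> i j. u j $ i)"

lemma unitary_columns_mat:
  assumes "onb u" shows "unitary_mat (columns_mat u)"
proof -
  have "mat_adj (columns_mat u) ** columns_mat u = mat 1"
    using assms
    by (simp add: vec_eq_iff matrix_matrix_mult_def mat_adj_def columns_mat_def onb_def mat_def
        cinner_def mult.commute)
  then show ?thesis using matrix_left_right_inverse by (auto simp: unitary_mat_def)
qed

lemma columns_mat_diag:
  "columns_mat u ** real_diag d ** mat_adj (columns_mat u) = diag_in u (($) d)"
  by (simp add: vec_eq_iff diag_in_def columns_mat_def matrix_matrix_mult_def real_diag_def mat_adj_def
      outer_def if_distrib if_distribR scaleR_conv_of_real[where 'a=complex] mult_ac cong: if_cong)

lemma spectral_fun_diag_in:
  assumes "onb u" shows "spectral_fun g (diag_in u d) = diag_in u (\<lambda>i. g (d i))"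
  using spectral_fun_eq[OF unitary_columns_mat[OF assms], of g "\<chi> i. d i"]
  unfolding columns_mat_diag by (simp add: diag_in_def)

lemma onb_expand:
  assumes "onb u" shows "x = (\<Sum>i\<in>UNIV. cinner x (u i) *s u i)"
proof -
  have "columns_mat u ** mat_adj (columns_mat u) = mat 1"
    using unitary_columns_mat[OF assms] by (simp add: unitary_mat_def)
  moreover have "columns_mat u ** mat_adj (columns_mat u) = (\<Sum>i\<in>UNIV. outer (u i))"
    by (simp add: vec_eq_iff columns_mat_def matrix_matrix_mult_def mat_adj_def outer_def)
  ultimately have "(\<Sum>i\<in>UNIV. outer (u i)) *v x = x" by simp
  then show ?thesis by (simp add: sum_mv outer_mv)
qed

lemma onb_ext:
  assumes "onb u" "\<And>i. A *v u i = B *v u i" shows "A = (B :: complex^'n^'n)"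
proof -
  have "A *v x = B *v x" for x
    by (subst (1 2) onb_expand[OF assms(1), of x]) (simp add: mv_sum assms(2))
  then show ?thesis by (simp add: matrix_eq)
qed

lemma diag_in_mv_basis:
  assumes "onb u" shows "diag_in u d *v u j = d j *\<^sub>R u j"
proof -
  have "diag_in u d *v u j = (\<Sum>i\<in>UNIV. if i = j then d j *\<^sub>R u j else 0)"
    using assms unfolding diag_in_def sum_mv onb_def by (intro sum.cong) (auto simp: outer_mv)
  then show ?thesis by simp
qed

lemma hermitian_diag_in [simp]: "hermitian_mat (diag_in u d)"
  unfolding diag_in_def by (intro hermitian_sum hermitian_simps) simp

section \<open>The spectral theorem\<close>

text \<open>Pairing with the vectors \<open>u i\<close> for \<open>i\<close> in \<open>S\<close>
  gives a linear endomorphism whose \<open>j\<close> coordinate always vanishes. It is not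
  surjective, hence not injective, and a nonzero kernel vector serves.\<close>

lemma exists_orthogonal:
  fixes u :: "'n \<Rightarrow> complex^'n"
  assumes "j \<notin> S"
  shows "\<exists>x. x \<noteq> 0 \<and> (\<forall>i\<in>S. cinner x (u i) = 0)"
proof (rule ccontr)
  assume a: "\<not> ?thesis"
  define T where "T x = (\<chi> i. if i \<in> S then cinner x (u i) else 0)" for x
  have lin: "linear T"
    by (rule linearI) (auto simp: T_def vec_eq_iff cinner_simps)
  have "inj T"
  proof (subst linear_injective_0[OF lin], intro allI impI)
    fix x assume "T x = 0"
    then have "\<forall>i\<in>S. cinner x (u i) = 0" by (auto simp: T_def vec_eq_iff split: if_splits)
    then show "x = 0" using a by blast
  qed
  then have "surj T" by (rule linear_injective_imp_surjective[OF lin]) simp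
  then obtain x where "T x = axis j 1" by (metis surjD)
  then have "T x $ j = 1" by (simp add: axis_def)
  then show False using assms by (simp add: T_def)
qed

text \<open>A maximizer of the Rayleigh quotient on an invariant subspace is an eigenvector.\<close>

lemma invariant_subspace_eigenvector:
  fixes A :: "complex^'n^'n"
  assumes A: "hermitian_mat A"
    and W: "subspace W" "\<And>x. x \<in> W \<Longrightarrow> A *v x \<in> W"
    and "x0 \<in> W" "x0 \<noteq> 0"
  shows "\<exists>x l. x \<in> W \<and> norm x = 1 \<and> A *v x = l *\<^sub>R x"
proof -
  define S where "S = W \<inter> sphere 0 1"
  have "compact S" unfolding S_def using closed_subspace[OF W(1)] by (intro closed_Int_compact) auto
  moreover have "S \<noteq> {}"
  proof -
    have "(1 / norm x0) *\<^sub>R x0 \<in> S"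
      using assms(4,5) subspace_scale[OF W(1)] by (auto simp: S_def)
    then show ?thesis by blast
  qed
  moreover have "continuous_on S (\<lambda>x. inner (A *v x) x)"
    by (intro continuous_intros linear_continuous_on linear_linear[THEN iffD1] matrix_vector_mul_linear)
  ultimately obtain x where x: "x \<in> S" and max: "\<And>y. y \<in> S \<Longrightarrow> inner (A *v y) y \<le> inner (A *v x) x"
    using continuous_attains_sup[of S "\<lambda>x. inner (A *v x) x"] by blast
  define l where "l = inner (A *v x) x"
  have nx: "norm x = 1" "x \<in> W" using x by (auto simp: S_def)
  \<comment> \<open>\<open>Q\<close> is nonnegative on \<open>W\<close> and vanishes at the
    maximizer \<open>x\<close>. If the defect \<open>A *v x - l *\<^sub>R x\<close> were nonzero,
    moving from \<open>x\<close> in its direction would make \<open>Q\<close> negative to first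
    order.\<close>
  define Q where "Q y = l * inner y y - inner (A *v y) y" for y
  have Qpos: "Q y \<ge> 0" if "y \<in> W" for y
  proof (cases "y = 0")
    case False
    have "(1 / norm y) *\<^sub>R y \<in> S" using that False subspace_scale[OF W(1)] by (auto simp: S_def)
    from max[OF this] have "inner (A *v y) y / (norm y)\<^sup>2 \<le> l"
      by (simp add: l_def power2_eq_square)
    then show ?thesis using False by (simp add: Q_def field_simps power2_norm_eq_inner)
  qed (simp add: Q_def)
  define y where "y = A *v x - l *\<^sub>R x"
  have yW: "y \<in> W" unfolding y_def using W nx(2) by (intro subspace_diff subspace_scale) auto
  have sym: "inner (A *v y) x = inner (A *v x) y"
    using hermitian_cinner[OF A, of y x] cinner_commute[of "A *v x" y]
    by (metis Re_cinner inner_commute)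
  have Qxy: "Q (x + t *\<^sub>R y) = t\<^sup>2 * Q y - 2 * t * inner y y" for t
  proof -
    have 1: "inner y y = inner (A *v x) y - l * inner x y"
      by (subst (1) y_def) (simp add: inner_diff_left)
    have 2: "inner x x = 1" using nx by (simp add: norm_eq_1)
    have 3: "inner (A *v (x + t *\<^sub>R y)) (x + t *\<^sub>R y) =
        l + 2 * t * inner (A *v x) y + t\<^sup>2 * inner (A *v y) y"
      unfolding matrix_vector_right_distrib mv_scaleR inner_add_left inner_add_right
        inner_scaleR_left inner_scaleR_right sym l_def by (simp add: power2_eq_square distrib_left)
    have 4: "inner (x + t *\<^sub>R y) (x + t *\<^sub>R y) = 1 + 2 * t * inner x y + t\<^sup>2 * inner y y"
      unfolding inner_add_left inner_add_right inner_scaleR_left inner_scaleR_right 2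
      using inner_commute[of x y] by (simp add: power2_eq_square distrib_left)
    show ?thesis unfolding Q_def 3 4 unfolding 1 by (simp add: algebra_simps)
  qed
  have "inner y y = 0"
  proof (rule ccontr)
    assume "inner y y \<noteq> 0"
    then have p: "inner y y > 0" by simp
    \<comment> \<open>Small enough for the linear term of \<open>Qxy\<close> to beat the quadratic
      one; adding \<open>1\<close> keeps the denominator positive when
      \<open>Q y = 0\<close>.\<close>
    define t where "t = inner y y / (Q y + 1)"
    have Qy: "Q y \<ge> 0" using Qpos yW by blast
    have tp: "t > 0" using p Qy by (simp add: t_def)
    have "t * Q y < 2 * inner y y"
    proof -
      have "t * Q y = inner y y * (Q y / (Q y + 1))" by (simp add: t_def)
      also have "\<dots> \<le> inner y y * 1" using p Qy by (intro mult_left_mono) (auto simp: field_simps)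
      finally show ?thesis using p by linarith
    qed
    then have "t * (t * Q y - 2 * inner y y) < 0" using tp by (intro mult_pos_neg) auto
    then have "Q (x + t *\<^sub>R y) < 0" by (simp add: Qxy power2_eq_square algebra_simps)
    moreover have "Q (x + t *\<^sub>R y) \<ge> 0" using W nx yW by (intro Qpos subspace_add subspace_scale) auto
    ultimately show False by simp
  qed
  then have "A *v x = l *\<^sub>R x" by (simp add: y_def)
  then show ?thesis using nx by blast
qed

text \<open>Induction on the index set: the orthogonal complement of the eigenvectors found so far
  is nonzero and invariant, so it contains another unit eigenvector.\<close>

theorem hermitian_spectral:
  fixes A :: "complex^'n^'n"
  assumes A: "hermitian_mat A"
  obtains u d where "onb u" "A = diag_in u d"
proof -
  have "\<exists>u d. (\<forall>i\<in>S. \<forall>j\<in>S. cinner (u i) (u j) = (if i = j then 1 else 0)) \<and>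
      (\<forall>i\<in>S. A *v u i = d i *\<^sub>R u i)" for S :: "'n set"
  proof (induction S rule: finite_induct[OF finite])
    case 1 show ?case by simp
  next
    case (2 j S)
    then obtain u d where u: "\<forall>i\<in>S. \<forall>j\<in>S. cinner (u i) (u j) = (if i = j then 1 else 0)"
      and d: "\<forall>i\<in>S. A *v u i = d i *\<^sub>R u i" by blast
    define W where "W = {x. \<forall>i\<in>S. cinner x (u i) = 0}"
    obtain x0 where "x0 \<in> W" "x0 \<noteq> 0"
      using exists_orthogonal[OF \<open>j \<notin> S\<close>, of u] unfolding W_def by blast
    moreover have "subspace W" by (auto simp: subspace_def W_def cinner_simps)
    moreover have "A *v x \<in> W" if "x \<in> W" for x
      using that d by (auto simp: W_def hermitian_cinner[OF A] cinner_simps)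
    ultimately obtain x l where x: "x \<in> W" "norm x = 1" "A *v x = l *\<^sub>R x"
      using invariant_subspace_eigenvector[OF A] by metis
    have x1: "\<forall>i\<in>S. cinner x (u i) = 0" "\<forall>i\<in>S. cinner (u i) x = 0"
      using x cinner_commute[of _ x] by (auto simp: W_def)
    have xx: "cinner x x = 1" using x(2) by (simp add: cinner_self)
    have "\<forall>i\<in>insert j S. \<forall>k\<in>insert j S. cinner ((u(j:=x)) i) ((u(j:=x)) k) = (if i = k then 1 else 0)"
      using u x1 xx \<open>j \<notin> S\<close> by auto
    moreover have "\<forall>i\<in>insert j S. A *v (u(j:=x)) i = (d(j:=l)) i *\<^sub>R (u(j:=x)) i"
      using d x(3) \<open>j \<notin> S\<close> by simp
    ultimately show ?case by blast
  qed
  from this[of UNIV] obtain u d where u: "onb u" and d: "\<forall>i. A *v u i = d i *\<^sub>R u i"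
    by (auto simp: onb_def)
  have "A = diag_in u d" by (rule onb_ext[OF u]) (simp add: d diag_in_mv_basis[OF u])
  then show ?thesis using u that by blast
qed

section \<open>Positive matrices and continuity of the functional calculus\<close>

definition psd :: "(complex^'n^'n) set" where
  "psd = {A. hermitian_mat A \<and> (\<forall>x. inner (A *v x) x \<ge> 0)}"

lemma pos_def_iff: "A \<in> pos_def \<longleftrightarrow> hermitian_mat A \<and> (\<forall>x. x \<noteq> 0 \<longrightarrow> inner (A *v x) x > 0)"
  by (simp add: pos_def_def Re_cinner)

lemma pos_def_hermitian: "A \<in> pos_def \<Longrightarrow> hermitian_mat A"
  by (simp add: pos_def_iff)

lemma psd_hermitian: "A \<in> psd \<Longrightarrow> hermitian_mat A"
  by (simp add: psd_def)

lemma psdD: "A \<in> psd \<Longrightarrow> inner (A *v x) x \<ge> 0"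
  by (simp add: psd_def)

lemma pos_def_imp_psd: "A \<in> pos_def \<Longrightarrow> A \<in> psd"
  by (auto simp: psd_def pos_def_iff less_imp_le) (metis inner_zero_right less_imp_le order_refl)

lemma psd_add_pos_def: "A \<in> psd \<Longrightarrow> B \<in> pos_def \<Longrightarrow> A + B \<in> pos_def"
  by (auto simp: psd_def pos_def_iff hermitian_simps matrix_vector_mult_add_rdistrib inner_add_left
      add_nonneg_pos)

lemma pos_def_scale: "r > 0 \<Longrightarrow> A \<in> pos_def \<Longrightarrow> r *\<^sub>R A \<in> pos_def"
  by (auto simp: pos_def_iff hermitian_simps)

lemma psd_scale: "r \<ge> 0 \<Longrightarrow> A \<in> psd \<Longrightarrow> r *\<^sub>R A \<in> psd"
  by (auto simp: psd_def hermitian_simps)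

lemma pos_def_one [simp]: "mat 1 \<in> pos_def"
  by (simp add: pos_def_iff hermitian_simps)

lemma psd_zero [simp]: "0 \<in> psd"
  by (simp add: psd_def hermitian_simps)

lemma inner_outer: "inner (outer v *v x) x = (norm (cinner x v))\<^sup>2"
proof -
  have "cinner (outer v *v x) x = cinner x v * cnj (cinner x v)"
    by (simp add: outer_mv cinner_simps cinner_commute[of v x])
  also have "\<dots> = of_real ((norm (cinner x v))\<^sup>2)" by (rule complex_norm_square[symmetric])
  finally show ?thesis using Re_cinner[of "outer v *v x" x] by simp
qed

lemma outer_psd [simp]: "outer v \<in> psd"
  by (simp add: psd_def inner_outer)

lemma onb_norm: "onb u \<Longrightarrow> norm (u i) = 1"
  by (metis Re_cinner norm_eq_1 one_complex.simps(1) onb_def)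

lemma diag_in_add: "diag_in u d + diag_in u e = diag_in u (\<lambda>i. d i + e i)"
  by (simp add: diag_in_def sum.distrib scaleR_add_left)

lemma diag_in_diff: "diag_in u d - diag_in u e = diag_in u (\<lambda>i. d i - e i)"
  by (simp add: diag_in_def sum_subtractf scaleR_diff_left)

lemma diag_in_scale: "r *\<^sub>R diag_in u d = diag_in u (\<lambda>i. r * d i)"
  by (simp add: diag_in_def scaleR_sum_right)

lemma diag_in_const:
  assumes "onb u" shows "diag_in u (\<lambda>_. c) = c *\<^sub>R mat 1"
  by (rule onb_ext[OF assms]) (simp add: diag_in_mv_basis[OF assms])

lemma diag_in_inner: "inner (diag_in u d *v x) x = (\<Sum>i\<in>UNIV. d i * (norm (cinner x (u i)))\<^sup>2)"
  by (simp add: diag_in_def sum_mv inner_sum_left inner_outer)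

lemma diag_in_psd_iff:
  assumes "onb u" shows "diag_in u d \<in> psd \<longleftrightarrow> (\<forall>i. d i \<ge> 0)"
proof
  assume "diag_in u d \<in> psd"
  then have "inner (diag_in u d *v u i) (u i) \<ge> 0" for i by (rule psdD)
  then show "\<forall>i. d i \<ge> 0"
    by (simp add: diag_in_mv_basis[OF assms] onb_norm[OF assms] dot_square_norm)
next
  assume "\<forall>i. d i \<ge> 0"
  then show "diag_in u d \<in> psd"
    by (auto simp: psd_def diag_in_inner intro!: sum_nonneg)
qed

lemma diag_in_pos_def_iff:
  assumes "onb u" shows "diag_in u d \<in> pos_def \<longleftrightarrow> (\<forall>i. d i > 0)"
proof
  assume "diag_in u d \<in> pos_def"
  moreover have "u i \<noteq> 0" for i using onb_norm[OF assms, of i] by auto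
  ultimately have "inner (diag_in u d *v u i) (u i) > 0" for i by (simp add: pos_def_iff)
  then show "\<forall>i. d i > 0"
    by (simp add: diag_in_mv_basis[OF assms] onb_norm[OF assms] dot_square_norm)
next
  assume d: "\<forall>i. d i > 0"
  \<comment> \<open>Splitting off the smallest eigenvalue leaves a semidefinite matrix plus a
    positive multiple of the identity.\<close>
  define m where "m = Min (range d)"
  have m: "m > 0" "\<forall>i. d i - m \<ge> 0" using d by (auto simp: m_def)
  have "diag_in u d = diag_in u (\<lambda>i. d i - m) + m *\<^sub>R mat 1"
    by (simp add: diag_in_const[OF assms, symmetric] diag_in_add)
  then show "diag_in u d \<in> pos_def"
    using m by (metis psd_add_pos_def diag_in_psd_iff[OF assms] pos_def_scale pos_def_one)
qed

text \<open>Both \<open>\<bar>d i\<bar> + 1\<close> and \<open>\<bar>d i\<bar> + 1 - d i\<close> are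
  positive. Such differences extend maps from \<open>pos_def\<close> to all hermitian
  matrices.\<close>

lemma hermitian_diff_pos_def:
  assumes "hermitian_mat A"
  obtains P Q where "P \<in> pos_def" "Q \<in> pos_def" "A = P - Q"
proof -
  obtain u d where u: "onb u" "A = diag_in u d" using hermitian_spectral[OF assms] .
  have "A = diag_in u (\<lambda>i. \<bar>d i\<bar> + 1) - diag_in u (\<lambda>i. \<bar>d i\<bar> + 1 - d i)"
    by (simp add: diag_in_diff u)
  moreover have "diag_in u (\<lambda>i. \<bar>d i\<bar> + 1) \<in> pos_def" "diag_in u (\<lambda>i. \<bar>d i\<bar> + 1 - d i) \<in> pos_def"
    by (auto simp: diag_in_pos_def_iff[OF u(1)] add_nonneg_pos)
  ultimately show ?thesis using that by blast
qed

lemma hermitian_eq_0: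
  assumes "hermitian_mat A" "\<And>x. norm x = 1 \<Longrightarrow> inner (A *v x) x = 0"
  shows "A = 0"
proof -
  obtain u d where u: "onb u" "A = diag_in u d" using hermitian_spectral[OF assms(1)] .
  have "d i = 0" for i
    using assms(2)[OF onb_norm[OF u(1), of i]] onb_norm[OF u(1), of i]
    by (simp add: u(2) diag_in_mv_basis[OF u(1)] dot_square_norm)
  then show ?thesis by (simp add: u(2) diag_in_def)
qed

text \<open>Idempotence makes each eigenvalue of \<open>outer v\<close> equal to 0 or 1, and at
  these two points \<open>g (t * x)\<close> agrees with the affine function
  \<open>g 0 + (g t - g 0) * x\<close>.\<close>

lemma spectral_fun_rank_one:
  assumes v: "norm v = 1"
  shows "spectral_fun g (t *\<^sub>R outer v) = g 0 *\<^sub>R mat 1 + (g t - g 0) *\<^sub>R outer v"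
proof -
  obtain u d where u: "onb u" "outer v = diag_in u d" using hermitian_spectral[of "outer v"] by auto
  have "d i = 0 \<or> d i = 1" for i
  proof -
    have "outer v *v (outer v *v u i) = outer v *v u i"
      using v by (simp add: outer_mv cinner_simps cinner_self)
    then have "(d i * d i - d i) *\<^sub>R u i = 0"
      by (simp add: u(2) diag_in_mv_basis[OF u(1)] scaleR_diff_left)
    then show ?thesis using onb_norm[OF u(1), of i] by (auto simp: algebra_simps)
  qed
  then have "(\<lambda>i. g (t * d i)) = (\<lambda>i. g 0 + (g t - g 0) * d i)" by (metis add.right_neutral
        add_diff_cancel_left' diff_add_cancel mult.right_neutral mult_zero_right add.commute)
  then show ?thesis
    by (simp add: u diag_in_scale spectral_fun_diag_in[OF u(1)] diag_in_const[OF u(1), symmetric]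
        diag_in_add)
qed

section \<open>Limits of matrices and of their functional calculus\<close>

lemma tendsto_mm:
  fixes A B :: "_ \<Rightarrow> complex^'n^'n"
  assumes "(A \<longlongrightarrow> A') F" "(B \<longlongrightarrow> B') F"
  shows "((\<lambda>k. A k ** B k) \<longlongrightarrow> A' ** B') F"
  unfolding matrix_matrix_mult_def
  by (intro tendsto_intros assms)

lemma tendsto_adj:
  assumes "(A \<longlongrightarrow> A') F" shows "((\<lambda>k. mat_adj (A k)) \<longlongrightarrow> mat_adj A') F"
  unfolding mat_adj_def by (intro tendsto_intros assms)

text \<open>Every row is a unit vector, so all unitary matrices have the same norm; the defining
  equations pass to limits.\<close>

lemma compact_unitary: "compact (Collect unitary_mat :: (complex^'n^'n) set)"
proof -
  have "norm U = L2_set (\<lambda>_::'n. 1) UNIV" if "unitary_mat U" for U :: "complex^'n^'n"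
  proof -
    have "cinner (U $ i) (U $ i) = 1" for i
      using that by (auto simp: unitary_mat_def vec_eq_iff matrix_matrix_mult_def mat_adj_def cinner_def mat_def)
    then have "norm (U $ i) = 1" for i
      by (metis Re_cinner norm_eq_1 one_complex.simps(1))
    then show ?thesis by (simp add: norm_vec_def)
  qed
  then have "bounded (Collect unitary_mat :: (complex^'n^'n) set)"
    by (auto simp: bounded_iff)
  moreover have "closed (Collect unitary_mat :: (complex^'n^'n) set)"
    unfolding closed_sequential_limits
  proof safe
    fix x and l :: "complex^'n^'n" assume x: "\<forall>n. x n \<in> Collect unitary_mat" and l: "x \<longlonglongrightarrow> l"
    have "(\<lambda>k. mat_adj (x k) ** x k) \<longlonglongrightarrow> mat_adj l ** l" "(\<lambda>k. x k ** mat_adj (x k)) \<longlonglongrightarrow> l ** mat_adj l"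
      by (intro tendsto_mm tendsto_adj l)+
    then show "unitary_mat l"
      using x unfolding unitary_mat_def by (auto dest: LIMSEQ_unique[OF tendsto_const])
  qed
  ultimately show ?thesis by (simp add: compact_eq_bounded_closed)
qed

lemma not_tendsto_subseq:
  fixes a :: "nat \<Rightarrow> 'a::metric_space"
  assumes "\<not> a \<longlonglongrightarrow> l"
  obtains r e where "strict_mono r" "e > 0" "\<And>k::nat. dist (a (r k)) l \<ge> e"
proof -
  obtain e where e: "e > 0" "\<not> (\<forall>\<^sub>F k in sequentially. dist (a k) l < e)"
    using assms unfolding tendsto_iff by blast
  then have "infinite {k. dist (a k) l \<ge> e}"
    unfolding eventually_cofinite[symmetric] cofinite_eq_sequentially[symmetric]
    by (simp add: eventually_cofinite not_less)
  then obtain r :: "nat \<Rightarrow> nat" where "strict_mono r" "\<And>k. r k \<in> {k. dist (a k) l \<ge> e}"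
    using infinite_enumerate by blast
  then show ?thesis using that e by auto
qed

lemma psd_diagonalize:
  assumes "A \<in> psd"
  shows "\<exists>U d. unitary_mat U \<and> A = U ** real_diag d ** mat_adj U \<and> (\<forall>i. d $ i \<ge> 0)"
proof -
  obtain u d where u: "onb u" "A = diag_in u d" using hermitian_spectral[OF psd_hermitian[OF assms]] .
  then have "A = columns_mat u ** real_diag (\<chi> i. d i) ** mat_adj (columns_mat u)"
    unfolding columns_mat_diag by (simp add: diag_in_def)
  moreover have "\<forall>i. d i \<ge> 0" using u assms diag_in_psd_iff by blast
  ultimately show ?thesis using unitary_columns_mat[OF u(1)] by fastforce
qed

text \<open>By compactness of the unitary group, every subsequence has a further subsequence along which
  the diagonalizations converge.\<close>

lemma tendsto_spectral_fun:
  fixes X :: "nat \<Rightarrow> complex^'n^'n"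
  assumes X: "\<And>k. X k \<in> psd" "X \<longlonglongrightarrow> Y" and g: "continuous_on {0..} g"
  shows "(\<lambda>k. spectral_fun g (X k)) \<longlonglongrightarrow> spectral_fun g Y"
proof (rule ccontr)
  assume "\<not> ?thesis"
  then obtain r e where r: "strict_mono r" "e > 0"
    and re: "\<And>k::nat. dist (spectral_fun g (X (r k))) (spectral_fun g Y) \<ge> e"
    using not_tendsto_subseq by blast
  have "\<forall>k. \<exists>U d. unitary_mat U \<and> X (r k) = U ** real_diag d ** mat_adj U \<and> (\<forall>i. d $ i \<ge> 0)"
    using psd_diagonalize X(1) by blast
  then obtain U d where U: "\<And>k. unitary_mat (U k)" and XU: "\<And>k. X (r k) = U k ** real_diag (d k) ** mat_adj (U k)"
    and d: "\<And>k i. d k $ i \<ge> 0" by metis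
  obtain V s where V: "unitary_mat V" and s: "strict_mono s" "(U \<circ> s) \<longlonglongrightarrow> V"
    using compact_unitary[unfolded compact_def, rule_format, of U] U by blast
  have Us: "(\<lambda>k. U (s k)) \<longlonglongrightarrow> V" using s by (simp add: o_def)
  have Xs: "(\<lambda>k. X (r (s k))) \<longlonglongrightarrow> Y"
    using LIMSEQ_subseq_LIMSEQ[OF X(2) strict_mono_o[OF r(1) s(1)]] by (simp add: o_def)
  \<comment> \<open>Solving for the diagonal factor shows that it converges along with
    \<open>U\<close> and \<open>X\<close>, so the eigenvalues need no compactness argument of their
    own.\<close>
  have rd: "real_diag (d k) = mat_adj (U k) ** X (r k) ** U k" for k
    using U[of k] unfolding XU unitary_mat_def
    by (metis matrix_mul_assoc matrix_mul_lid matrix_mul_rid)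
  have lim: "(\<lambda>k. real_diag (d (s k))) \<longlonglongrightarrow> mat_adj V ** Y ** V" (is "_ \<longlonglongrightarrow> ?D")
    unfolding rd by (intro tendsto_mm tendsto_adj Us Xs)
  define f where "f = (\<chi> i. Re (?D $ i $ i))"
  have df: "(\<lambda>k. d (s k) $ i) \<longlonglongrightarrow> f $ i" for i
  proof -
    have "(\<lambda>k. Re (real_diag (d (s k)) $ i $ i)) \<longlonglongrightarrow> Re (?D $ i $ i)"
      by (intro tendsto_intros lim)
    then show ?thesis by (simp add: real_diag_def f_def)
  qed
  have f0: "f $ i \<ge> 0" for i by (rule LIMSEQ_le_const[OF df]) (use d in auto)
  have real_diag_lim: "(\<lambda>k. real_diag (\<chi> i. p k i)) \<longlonglongrightarrow> real_diag (\<chi> i. q i)"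
    if "\<And>i. (\<lambda>k. p k i) \<longlonglongrightarrow> q i" for p :: "nat \<Rightarrow> 'n \<Rightarrow> real" and q
    unfolding real_diag_def
  proof (intro vec_tendstoI)
    fix i j
    show "(\<lambda>k. (\<chi> i j. if i = j then complex_of_real ((\<chi> i. p k i) $ i) else 0) $ i $ j) \<longlonglongrightarrow>
        (\<chi> i j. if i = j then complex_of_real ((\<chi> i. q i) $ i) else 0) $ i $ j"
      by (cases "i = j") (auto intro!: tendsto_of_real that)
  qed
  have "?D = real_diag f"
    using LIMSEQ_unique[OF lim] real_diag_lim[of "\<lambda>k i. d (s k) $ i" "($) f", OF df]
    by (simp add: vec_lambda_eta)
  then have Y: "Y = V ** real_diag f ** mat_adj V"
    using V unfolding unitary_mat_def by (metis matrix_mul_assoc matrix_mul_lid matrix_mul_rid)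
  have "(\<lambda>k. U (s k) ** real_diag (\<chi> i. g (d (s k) $ i)) ** mat_adj (U (s k))) \<longlonglongrightarrow>
      V ** real_diag (\<chi> i. g (f $ i)) ** mat_adj V"
  proof (intro tendsto_mm tendsto_adj Us real_diag_lim)
    fix i
    show "(\<lambda>k. g (d (s k) $ i)) \<longlonglongrightarrow> g (f $ i)"
      by (rule continuous_on_tendsto_compose[OF g df]) (use d f0 in auto)
  qed
  then have "(\<lambda>k. spectral_fun g (X (r (s k)))) \<longlonglongrightarrow> spectral_fun g Y"
    unfolding XU Y by (simp add: spectral_fun_eq U V)
  then have "(\<lambda>k. dist (spectral_fun g (X (r (s k)))) (spectral_fun g Y)) \<longlonglongrightarrow> 0"
    by (rule iffD1[OF tendsto_dist_iff])
  then have "e \<le> 0" by (rule LIMSEQ_le_const) (use re in auto)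
  then show False using r by simp
qed

section \<open>Derivatives of convex functions and their extension to zero\<close>

text \<open>Everything rests on the tangent inequality: two tangents compare the derivatives at
  their points, and secant slopes, continuous in the base point, bound the derivative from either
  side.\<close>

lemma convex_deriv_continuous:
  fixes f :: "real \<Rightarrow> real"
  assumes f: "convex_on {0<..} f" and d: "\<forall>x>0. f differentiable at x"
  shows "mono_on {0<..} (deriv f)" and "continuous_on {0<..} (deriv f)"
proof -
  have D: "(f has_real_derivative deriv f x) (at x)" if "x > 0" for x
    using d that by (simp add: DERIV_deriv_iff_real_differentiable)
  have tan: "f z - f y \<ge> deriv f y * (z - y)" if "y > 0" "z > 0" for y z
    by (rule convex_on_imp_above_tangent[OF f])
      (use that in \<open>auto intro: has_field_derivative_at_within[OF D] simp: interior_open\<close>)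
  have mono: "deriv f x \<le> deriv f y" if "0 < x" "x \<le> y" for x y
  proof (cases "x = y")
    case False
    have "deriv f x * (y - x) \<le> f y - f x" "deriv f y * (x - y) \<le> f x - f y" using tan that by auto
    then have "(deriv f y - deriv f x) * (y - x) \<ge> 0" by (simp add: algebra_simps)
    then show ?thesis using that False by (simp add: zero_le_mult_iff)
  qed simp
  then show "mono_on {0<..} (deriv f)" by (auto intro: mono_onI)
  show "continuous_on {0<..} (deriv f)"
    unfolding continuous_on_eq_continuous_at[OF open_greaterThan]
  proof
    fix x :: real assume "x \<in> {0<..}"
    then have x: "x > 0" by simp
    have fc: "isCont f y" if "y > 0" for y using D[OF that] DERIV_isCont by blast
    have slope: "((\<lambda>z. (f z - f x) / (z - x)) \<longlongrightarrow> deriv f x) (at x)"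
      using D[OF x] by (simp add: has_field_derivative_iff)
    show "isCont (deriv f) x"
      unfolding isCont_def
    proof (rule order_tendstoI)
      fix a assume a: "deriv f x < a"
      \<comment> \<open>Some secant from \<open>x\<close> to a \<open>z > x\<close> has slope below
        \<open>a\<close>. This persists when the base point moves to a nearby \<open>y\<close>, and
        that slope bounds \<open>deriv f y\<close> from above.\<close>
      have "\<forall>\<^sub>F z in at_right x. (f z - f x) / (z - x) < a"
        using order_tendstoD(2)[OF slope a] by (simp add: eventually_at_split)
      then have "\<forall>\<^sub>F z in at_right x. (f z - f x) / (z - x) < a \<and> z > x"
        using eventually_at_right_less[of x] by eventually_elim simp
      then obtain z where z: "(f z - f x) / (z - x) < a" "z > x"
        using eventually_happens[of _ "at_right x"] by fastforce
      have "((\<lambda>y. (f z - f y) / (z - y)) \<longlongrightarrow> (f z - f x) / (z - x)) (at x)"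
        using z fc[OF x] by (intro tendsto_intros) (auto simp: isCont_def)
      then have "\<forall>\<^sub>F y in at x. (f z - f y) / (z - y) < a" using z by (auto dest: order_tendstoD)
      moreover have "\<forall>\<^sub>F y in at x. y \<in> {0<..<z}"
        by (rule eventually_at_in_open') (use x z in auto)
      ultimately show "\<forall>\<^sub>F y in at x. deriv f y < a"
      proof eventually_elim
        case (elim y)
        have "deriv f y \<le> (f z - f y) / (z - y)" using tan[of y z] elim x z by (simp add: field_simps)
        then show ?case using elim by simp
      qed
    next
      fix a assume a: "a < deriv f x"
      have "\<forall>\<^sub>F z in at_left x. (f z - f x) / (z - x) > a"
        using order_tendstoD(1)[OF slope a] by (simp add: eventually_at_split)
      moreover have "\<forall>\<^sub>F z in at_left x. z \<in> {0<..<x}"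
        using eventually_at_left_real[OF x] by simp
      ultimately have "\<forall>\<^sub>F z in at_left x. (f z - f x) / (z - x) > a \<and> z < x \<and> z > 0"
        by eventually_elim simp
      then obtain z where z: "(f z - f x) / (z - x) > a" "z < x" "z > 0"
        using eventually_happens[of _ "at_left x"] by fastforce
      have "((\<lambda>y. (f z - f y) / (z - y)) \<longlongrightarrow> (f z - f x) / (z - x)) (at x)"
        using z fc[OF x] by (intro tendsto_intros) (auto simp: isCont_def)
      then have "\<forall>\<^sub>F y in at x. (f z - f y) / (z - y) > a" using z by (auto dest: order_tendstoD)
      moreover have "\<forall>\<^sub>F y in at x. y \<in> {z<..}"
        by (rule eventually_at_in_open') (use x z in auto)
      ultimately show "\<forall>\<^sub>F y in at x. deriv f y > a"
      proof eventually_elim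
        case (elim y)
        have "deriv f y * (z - y) \<le> f z - f y" using tan[of y z] elim z by auto
        then have "deriv f y \<ge> (f z - f y) / (z - y)" using elim by (simp add: neg_divide_le_eq)
        then show ?case using elim by simp
      qed
    qed
  qed
qed

text \<open>For a monotone function bounded below, the infimum is the limit at \<open>0\<close> from
  the right. This makes the functional calculus of the derivative available for singular
  matrices.\<close>

lemma mono_bounded_continuous_extension:
  fixes g :: "real \<Rightarrow> real"
  assumes mono: "mono_on {0<..} g" and cont: "continuous_on {0<..} g" and bdd: "bdd_below (g ` {0<..})"
  defines "h \<equiv> \<lambda>x. if x > 0 then g x else Inf (g ` {0<..})"
  shows "continuous_on {0..} h" and "mono_on {0..} h"
proof -
  have low: "Inf (g ` {0<..}) \<le> g x" if "x > 0" for x using bdd that by (intro cInf_lower) auto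
  show "mono_on {0..} h" using mono low by (auto simp: h_def mono_on_def)
  show "continuous_on {0..} h"
    unfolding continuous_on_eq_continuous_within
  proof
    fix x :: real assume "x \<in> {0..}"
    then consider "x > 0" | "x = 0" by fastforce
    then show "continuous (at x within {0..}) h"
    proof cases
      case 1
      have "continuous_on {0<..} h" using cont by (rule continuous_on_eq) (simp add: h_def)
      then have "isCont h x" using 1 by (simp add: continuous_on_eq_continuous_at)
      then show ?thesis by (rule continuous_at_imp_continuous_at_within)
    next
      case 2
      have "(h \<longlongrightarrow> h 0) (at 0 within {0..})"
      proof (rule order_tendstoI)
        fix a assume "h 0 < a"
        then obtain z where z: "z > 0" "g z < a"
          using cInf_lessD[of "g ` {0<..}" a] by (auto simp: h_def)
        have "\<forall>\<^sub>F y in at 0 within {0..}. y < z"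
          using z by (auto simp: eventually_at intro!: exI[of _ z] simp: dist_real_def)
        moreover have "\<forall>\<^sub>F y in at 0 within {0..}. y \<in> {0..} - {0::real}"
          by (auto simp: eventually_at_filter)
        ultimately show "\<forall>\<^sub>F y in at 0 within {0..}. h y < a"
        proof eventually_elim
          case (elim y)
          then have "h y \<le> g z" using mono z by (auto simp: h_def mono_on_def)
          then show ?case using z by simp
        qed
      next
        fix a assume "a < h 0"
        moreover have "h 0 \<le> h y" if "y \<ge> 0" for y using low that by (auto simp: h_def)
        ultimately show "\<forall>\<^sub>F y in at 0 within {0..}. a < h y"
          by (auto simp: eventually_at_filter intro!: always_eventually) (meson less_le_trans)
      qed
      then show ?thesis using 2 by (simp add: continuous_within)
    qed
  qed
qed

section \<open>Linear extension of a preserver\<close>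

text \<open>On vectors orthogonal to \<open>v\<close> the quadratic form of \<open>B\<close> is
  squeezed to zero, so each eigenvector of \<open>B\<close> with nonzero eigenvalue lies on the line
  of \<open>v\<close>.\<close>

lemma rank_one_extreme:
  assumes v: "norm v = 1" and B: "B \<in> psd" "outer v - B \<in> psd"
  shows "\<exists>t. B = t *\<^sub>R outer v"
proof -
  obtain u d where u: "onb u" "B = diag_in u d" using hermitian_spectral[OF psd_hermitian[OF B(1)]] .
  have d: "d i \<ge> 0" for i using B(1) u diag_in_psd_iff by blast
  have vv: "cinner v v = 1" using v by (simp add: cinner_self)
  have "\<exists>t. d i *\<^sub>R outer (u i) = t *\<^sub>R outer v" for i
  proof (cases "d i = 0")
    case True
    then show ?thesis by (intro exI[of _ 0]) simp
  next
    case False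
    \<comment> \<open>The component of \<open>u i\<close> orthogonal to \<open>v\<close>, to be
      shown zero.\<close>
    define x where "x = u i - cinner (u i) v *s v"
    have xv: "cinner x v = 0" by (simp add: x_def cinner_simps vv)
    then have "inner (outer v *v x) x = 0" by (simp add: inner_outer)
    then have "inner (B *v x) x \<le> 0" using psdD[OF B(2), of x]
      by (simp add: matrix_vector_mult_diff_rdistrib inner_diff_left)
    then have "(\<Sum>j\<in>UNIV. d j * (norm (cinner x (u j)))\<^sup>2) \<le> 0"
      by (simp add: u(2) diag_in_inner)
    moreover have "d i * (norm (cinner x (u i)))\<^sup>2 \<le> (\<Sum>j\<in>UNIV. d j * (norm (cinner x (u j)))\<^sup>2)"
      using d by (intro member_le_sum) auto
    ultimately have "d i * (norm (cinner x (u i)))\<^sup>2 \<le> 0" by linarith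
    then have "cinner x (u i) = 0" using d[of i] False by (simp add: mult_le_0_iff)
    then have "cinner x x = 0" using xv
      by (subst (2) x_def) (simp add: cinner_simps)
    then have "u i = cinner (u i) v *s v" by (simp add: x_def)
    then have "outer (u i) = (norm (cinner (u i) v))\<^sup>2 *\<^sub>R outer v" by (metis outer_scale)
    then show ?thesis by auto
  qed
  then obtain t where "\<And>i. d i *\<^sub>R outer (u i) = t i *\<^sub>R outer v" by metis
  then have "B = (\<Sum>i\<in>UNIV. t i) *\<^sub>R outer v" by (simp add: u diag_in_def scaleR_sum_left)
  then show ?thesis by blast
qed

lemma tendsto_add_scaled:
  fixes A B :: "'a::real_normed_vector"
  shows "(\<lambda>k. A + inverse (real (Suc k)) *\<^sub>R B) \<longlonglongrightarrow> A"
proof -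
  have "(\<lambda>k. A + inverse (real (Suc k)) *\<^sub>R B) \<longlonglongrightarrow> A + 0 *\<^sub>R B"
    by (intro tendsto_intros LIMSEQ_inverse_real_of_nat)
  then show ?thesis by simp
qed

lemma psd_plus_pos_def: "A \<in> psd \<Longrightarrow> A + inverse (real (Suc k)) *\<^sub>R mat 1 \<in> pos_def"
  by (intro psd_add_pos_def pos_def_scale) auto

text \<open>A locale, so that all results also apply to the inverse of \<open>\<phi>\<close>, which
  is another instance.\<close>

locale bregman_preserver =
  fixes f :: "real \<Rightarrow> real"
    and \<phi> :: "complex^'n^'n \<Rightarrow> complex^'n^'n"
  assumes convex: "convex_on {0<..} f"
    and diff: "\<forall>x>0. f differentiable at x"
    and bdd: "bdd_below (deriv f ` {0<..})"
    and unbdd: "\<not> bdd_above (deriv f ` {0<..})"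
    and bij: "bij_betw \<phi> pos_def pos_def"
    and pres: "\<forall>A\<in>pos_def. \<forall>B\<in>pos_def. bregman f (\<phi> A) (\<phi> B) = bregman f A B"
begin

lemma phi_pos_def: "A \<in> pos_def \<Longrightarrow> \<phi> A \<in> pos_def"
  using bij by (auto simp: bij_betw_def)

lemma phi_surj: assumes "X \<in> pos_def" obtains A where "A \<in> pos_def" "\<phi> A = X"
proof -
  have "X \<in> \<phi> ` pos_def" using bij assms by (simp add: bij_betw_def)
  then show ?thesis using that by blast
qed

lemma hermitian_phi: "A \<in> pos_def \<Longrightarrow> hermitian_mat (\<phi> A)"
  by (simp add: phi_pos_def pos_def_hermitian)

abbreviation "F \<equiv> spectral_fun (deriv f)"

text \<open>The alternating sum of four divergences cancels every spectral value of \<open>f\<close>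
  and leaves an expression linear in \<open>A - B\<close>.\<close>

lemma four_point:
  assumes "X \<in> pos_def" "Y \<in> pos_def" "A \<in> pos_def" "B \<in> pos_def"
  shows "trace ((F (\<phi> X) - F (\<phi> Y)) ** (\<phi> A - \<phi> B)) = trace ((F X - F Y) ** (A - B))"
proof -
  have "bregman f B X - bregman f A X + bregman f A Y - bregman f B Y =
      trace ((F X - F Y) ** (A - B))" for A B X Y :: "complex^'n^'n"
    by (simp add: bregman_def trace_sub mm_diff)
  then show ?thesis using pres assms by metis
qed

text \<open>In an eigenbasis of \<open>C\<close>, changing one eigenvalue of a scalar matrix from
  \<open>a\<close> to \<open>b\<close> changes \<open>F\<close> by a nonzero multiple of one
  projection, and pairing with it reads off an eigenvalue of \<open>C\<close>.\<close>

lemma deriv_differences_separate: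
  assumes C: "hermitian_mat C"
    and 0: "\<And>X Y. X \<in> pos_def \<Longrightarrow> Y \<in> pos_def \<Longrightarrow> trace ((F X - F Y) ** C) = 0"
  shows "C = 0"
proof -
  \<comment> \<open>If no two values differed, \<open>deriv f\<close> would be constant and thus
    bounded above, contrary to \<open>unbdd\<close>.\<close>
  obtain a b where ab: "a > 0" "b > 0" "deriv f a \<noteq> deriv f b"
  proof (rule ccontr)
    note witness = that
    assume a: "\<not> thesis"
    have "deriv f x \<le> deriv f 1" if x: "x > 0" for x
      using a witness[OF x zero_less_one] by (metis order_refl)
    then have "bdd_above (deriv f ` {0<..})" by (auto intro!: bdd_aboveI[of _ "deriv f 1"])
    then show False using unbdd by simp
  qed
  obtain u e where u: "onb u" "C = diag_in u e" using hermitian_spectral[OF C] .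
  have "e j = 0" for j
  proof -
    have *: "F (diag_in u (\<lambda>i. if i = j then b else a)) - F (diag_in u (\<lambda>i. a)) =
        (deriv f b - deriv f a) *\<^sub>R outer (u j)"
      unfolding spectral_fun_diag_in[OF u(1)] diag_in_diff
      by (simp add: diag_in_def if_distrib if_distribR cong: if_cong)
    have "trace ((F (diag_in u (\<lambda>i. if i = j then b else a)) - F (diag_in u (\<lambda>i. a))) ** C) = 0"
      by (rule 0) (auto simp: diag_in_pos_def_iff[OF u(1)] ab)
    then have "cinner (C *v u j) (u j) = 0"
      using ab unfolding * by (simp add: mm_scaleR trace_scaleR trace_outer)
    moreover have "cinner (u j) (u j) = 1" using u by (simp add: onb_def)
    ultimately show ?thesis by (simp add: u diag_in_mv_basis cinner_simps)
  qed
  then show ?thesis by (simp add: u diag_in_def)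
qed

text \<open>By surjectivity, \<open>four_point\<close> becomes a test against all positive definite
  \<open>X\<close> and \<open>Y\<close>, under which the defect of linearity pairs to zero. Both the
  well-definedness and the linearity of \<open>L\<close> follow from this.\<close>

lemma phi_differences:
  assumes pd: "A \<in> pos_def" "B \<in> pos_def" "A1 \<in> pos_def" "B1 \<in> pos_def" "A2 \<in> pos_def" "B2 \<in> pos_def"
    and eq: "A - B = s *\<^sub>R (A1 - B1) + t *\<^sub>R (A2 - B2)"
  shows "\<phi> A - \<phi> B = s *\<^sub>R (\<phi> A1 - \<phi> B1) + t *\<^sub>R (\<phi> A2 - \<phi> B2)"
proof -
  have "\<phi> A - \<phi> B - (s *\<^sub>R (\<phi> A1 - \<phi> B1) + t *\<^sub>R (\<phi> A2 - \<phi> B2)) = 0" (is "?C = 0")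
  proof (rule deriv_differences_separate)
    show "hermitian_mat ?C" using pd by (intro hermitian_simps hermitian_phi)
    fix X Y :: "complex^'n^'n" assume "X \<in> pos_def" "Y \<in> pos_def"
    then obtain X' Y' where X: "X' \<in> pos_def" "\<phi> X' = X" "Y' \<in> pos_def" "\<phi> Y' = Y"
      using phi_surj by metis
    have tr: "trace ((F X - F Y) ** (\<phi> P - \<phi> Q)) = trace ((F X' - F Y') ** (P - Q))"
      if "P \<in> pos_def" "Q \<in> pos_def" for P Q
      using four_point[OF X(1,3) that] X by simp
    have "trace ((F X - F Y) ** ?C) = trace ((F X - F Y) ** (\<phi> A - \<phi> B))
        - s *\<^sub>R trace ((F X - F Y) ** (\<phi> A1 - \<phi> B1)) - t *\<^sub>R trace ((F X - F Y) ** (\<phi> A2 - \<phi> B2))"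
      by (simp only: mm_diff(2) matrix_add_ldistrib trace_sub trace_add mm_scaleR trace_scaleR) simp
    also have "\<dots> = trace ((F X' - F Y') ** (A - B - (s *\<^sub>R (A1 - B1) + t *\<^sub>R (A2 - B2))))"
      unfolding tr[OF pd(1,2)] tr[OF pd(3,4)] tr[OF pd(5,6)]
      by (simp only: mm_diff(2) matrix_add_ldistrib trace_sub trace_add mm_scaleR trace_scaleR) simp
    also have "\<dots> = 0" unfolding eq by (simp add: trace_def)
    finally show "trace ((F X - F Y) ** ?C) = 0" .
  qed
  then show ?thesis by simp
qed

text \<open>Passing to the hermitian part makes the map total and real linear on all matrices; by
  \<open>phi_differences\<close> the choice of \<open>P\<close> and \<open>Q\<close> is
  immaterial.\<close>

definition L :: "complex^'n^'n \<Rightarrow> complex^'n^'n" where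
  "L A = (SOME D. \<exists>P\<in>pos_def. \<exists>Q\<in>pos_def. P - Q = (1/2) *\<^sub>R (A + mat_adj A) \<and> D = \<phi> P - \<phi> Q)"

lemma L_decomp:
  "\<exists>P\<in>pos_def. \<exists>Q\<in>pos_def. P - Q = (1/2) *\<^sub>R (A + mat_adj A) \<and> L A = \<phi> P - \<phi> Q"
proof -
  have "hermitian_mat ((1/2) *\<^sub>R (A + mat_adj A))" by (simp add: hermitian_mat_def add.commute)
  from hermitian_diff_pos_def[OF this] obtain P Q where
    "P \<in> pos_def" "Q \<in> pos_def" "P - Q = (1/2) *\<^sub>R (A + mat_adj A)" by metis
  then have "\<exists>D. \<exists>P\<in>pos_def. \<exists>Q\<in>pos_def. P - Q = (1/2) *\<^sub>R (A + mat_adj A) \<and> D = \<phi> P - \<phi> Q"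
    by blast
  from someI_ex[OF this] show ?thesis unfolding L_def .
qed

lemma L_diff:
  assumes "P \<in> pos_def" "Q \<in> pos_def" shows "L (P - Q) = \<phi> P - \<phi> Q"
proof -
  obtain P' Q' where PQ: "P' \<in> pos_def" "Q' \<in> pos_def" "L (P - Q) = \<phi> P' - \<phi> Q'"
    and eq: "P' - Q' = (1/2) *\<^sub>R ((P - Q) + mat_adj (P - Q))"
    using L_decomp[of "P - Q"] by metis
  have "mat_adj (P - Q) = P - Q" using assms by (simp add: pos_def_iff hermitian_mat_def)
  \<comment> \<open>With scalars \<open>1\<close> and \<open>0\<close>,
    \<open>phi_differences\<close> expresses independence of the decomposition.\<close>
  then have "P' - Q' = 1 *\<^sub>R (P - Q) + 0 *\<^sub>R (P - Q)"
    unfolding eq by (simp add: scaleR_2[symmetric])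
  from phi_differences[OF PQ(1,2) assms assms this] PQ show ?thesis by simp
qed

lemma L_lin: "L (s *\<^sub>R A + t *\<^sub>R B) = s *\<^sub>R L A + t *\<^sub>R L B"
proof -
  obtain P Q where 0: "P \<in> pos_def" "Q \<in> pos_def"
    "P - Q = (1/2) *\<^sub>R ((s *\<^sub>R A + t *\<^sub>R B) + mat_adj (s *\<^sub>R A + t *\<^sub>R B))"
    "L (s *\<^sub>R A + t *\<^sub>R B) = \<phi> P - \<phi> Q"
    using L_decomp by metis
  obtain P1 Q1 where 1: "P1 \<in> pos_def" "Q1 \<in> pos_def" "P1 - Q1 = (1/2) *\<^sub>R (A + mat_adj A)"
    "L A = \<phi> P1 - \<phi> Q1" using L_decomp by metis
  obtain P2 Q2 where 2: "P2 \<in> pos_def" "Q2 \<in> pos_def" "P2 - Q2 = (1/2) *\<^sub>R (B + mat_adj B)"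
    "L B = \<phi> P2 - \<phi> Q2" using L_decomp by metis
  have "P - Q = s *\<^sub>R (P1 - Q1) + t *\<^sub>R (P2 - Q2)"
    unfolding 0 1 2 by (simp add: algebra_simps)
  from phi_differences[OF 0(1,2) 1(1,2) 2(1,2) this] show ?thesis by (simp add: 0 1 2)
qed

lemma linear_L: "linear L"
proof (rule linearI)
  show "L (A + B) = L A + L B" for A B using L_lin[of 1 A 1 B] by simp
  show "L (r *\<^sub>R A) = r *\<^sub>R L A" for r A using L_lin[of r A 0 A] by simp
qed

lemma hermitian_L: "hermitian_mat (L A)"
  using L_decomp[of A] by (metis hermitian_simps(2) hermitian_phi)

text \<open>Differences determine \<open>\<phi>\<close> up to a constant \<open>C\<close>. Scaling
  arguments up shows that \<open>L\<close> is positive, scaling them down that \<open>C\<close> is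
  semidefinite, and surjectivity onto small multiples of the identity that \<open>- C\<close> is
  too.\<close>

lemma phi_eq_L:
  assumes "A \<in> pos_def" shows "\<phi> A = L A"
proof -
  define C where "C = \<phi> (mat 1) - L (mat 1)"
  have phi: "\<phi> A = L A + C" if "A \<in> pos_def" for A
    using L_diff[OF that pos_def_one] by (simp add: C_def linear_diff[OF linear_L] algebra_simps)
  have C: "hermitian_mat C" unfolding C_def by (intro hermitian_simps hermitian_phi hermitian_L pos_def_one)
  have ray: "t * inner (L A *v x) x + inner (C *v x) x \<ge> 0" if "A \<in> pos_def" "t > 0" for A t x
  proof -
    have "\<phi> (t *\<^sub>R A) \<in> psd" using that by (intro pos_def_imp_psd phi_pos_def pos_def_scale)
    then have "inner (\<phi> (t *\<^sub>R A) *v x) x \<ge> 0" by (rule psdD)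
    then show ?thesis using phi[OF pos_def_scale[OF that(2,1)]]
      by (simp add: linear_scale[OF linear_L] matrix_vector_mult_add_rdistrib inner_add_left)
  qed
  have Lpos: "inner (L A *v x) x \<ge> 0" if "A \<in> pos_def" for A x
  proof (rule ccontr)
    let ?a = "inner (L A *v x) x" and ?c = "inner (C *v x) x"
    assume "\<not> ?a \<ge> 0"
    then have a: "?a < 0" by simp
    define t where "t = (\<bar>?c\<bar> + 1) / (- ?a)"
    have "t > 0" unfolding t_def using a by (intro divide_pos_pos) auto
    moreover have "t * ?a = - (\<bar>?c\<bar> + 1)" using a by (simp add: t_def)
    ultimately show False using ray[OF that, of t x] by linarith
  qed
  have Cpos: "inner (C *v x) x \<ge> 0" for x
  proof (rule field_le_epsilon)
    let ?a = "inner (L (mat 1) *v x) x"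
    fix e :: real assume e: "e > 0"
    have a: "?a \<ge> 0" by (rule Lpos) simp
    define t where "t = e / (?a + 1)"
    have "t > 0" using e a by (simp add: t_def)
    moreover have "t * ?a \<le> e"
      using e a by (simp add: t_def field_simps)
    ultimately show "0 \<le> inner (C *v x) x + e" using ray[OF pos_def_one, of t x] by linarith
  qed
  have Cneg: "inner (C *v x) x \<le> 0" if x: "norm x = 1" for x
  proof (rule field_le_epsilon)
    fix e :: real assume e: "e > 0"
    then have "e *\<^sub>R mat 1 \<in> pos_def" by (intro pos_def_scale) auto
    then obtain A where A: "A \<in> pos_def" "\<phi> A = e *\<^sub>R mat 1" using phi_surj by metis
    have "L A = e *\<^sub>R mat 1 - C" using phi[OF A(1)] A by simp
    then have "inner (L A *v x) x = e * inner x x - inner (C *v x) x"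
      by (simp add: matrix_vector_mult_diff_rdistrib inner_diff_left)
    moreover have "inner x x = 1" using x by (simp add: norm_eq_1)
    ultimately show "inner (C *v x) x \<le> 0 + e" using Lpos[OF A(1), of x] by simp
  qed
  have "C = 0" by (rule hermitian_eq_0[OF C]) (use Cpos Cneg in \<open>simp add: order_antisym\<close>)
  then show ?thesis using phi[OF assms] by simp
qed

section \<open>The linear extension on the semidefinite cone\<close>

lemma L_pos_def: "A \<in> pos_def \<Longrightarrow> L A \<in> pos_def"
  using phi_pos_def phi_eq_L by metis

lemma L_approx: "L (A + inverse (real (Suc k)) *\<^sub>R mat 1) = L A + inverse (real (Suc k)) *\<^sub>R L (mat 1)"
  by (simp add: linear_add[OF linear_L] linear_scale[OF linear_L])

lemma L_psd:
  assumes "A \<in> psd" shows "L A \<in> psd"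
proof -
  have "inner (L A *v x) x \<ge> 0" for x
  proof (rule field_le_epsilon)
    let ?a = "inner (L (mat 1) *v x) x"
    fix e :: real assume e: "e > 0"
    have a: "?a \<ge> 0" by (intro psdD pos_def_imp_psd L_pos_def pos_def_one)
    define t where "t = e / (?a + 1)"
    have t: "t > 0" using e a by (simp add: t_def)
    have "t * ?a \<le> e" using e a by (simp add: t_def field_simps)
    moreover have "L (A + t *\<^sub>R mat 1) \<in> psd"
      by (rule pos_def_imp_psd[OF L_pos_def[OF psd_add_pos_def[OF assms pos_def_scale[OF t pos_def_one]]]])
    from psdD[OF this, of x] have "inner (L A *v x) x + t * ?a \<ge> 0"
      by (simp add: linear_add[OF linear_L] linear_scale[OF linear_L] matrix_vector_mult_add_rdistrib
          inner_add_left)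
    ultimately show "0 \<le> inner (L A *v x) x + e" by linarith
  qed
  then show ?thesis by (simp add: psd_def hermitian_L)
qed

text \<open>The value at \<open>0\<close> is the right limit of \<open>deriv f\<close>, which exists
  because \<open>deriv f\<close> is monotone and bounded below.\<close>

definition h :: "real \<Rightarrow> real" where
  "h x = (if x > 0 then deriv f x else Inf (deriv f ` {0<..}))"

lemma continuous_h: "continuous_on {0..} h" and mono_h: "mono_on {0..} h"
  using mono_bounded_continuous_extension[OF convex_deriv_continuous[OF convex diff] bdd]
  unfolding h_def[abs_def] by auto

abbreviation "G \<equiv> spectral_fun h"

lemma G_eq_F:
  assumes "X \<in> pos_def" shows "G X = F X"
proof -
  obtain u d where u: "onb u" "X = diag_in u d" using hermitian_spectral[OF pos_def_hermitian[OF assms]] .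
  then have "d i > 0" for i using assms diag_in_pos_def_iff by blast
  then show ?thesis by (simp add: u spectral_fun_diag_in h_def)
qed

text \<open>Both sides are continuous in semidefinite \<open>X\<close> and \<open>Y\<close>, and
  adding small multiples of the identity reduces to \<open>four_point\<close>. The gain is that
  \<open>0\<close> and rank one matrices become admissible.\<close>

lemma trace_identity:
  assumes X: "X \<in> psd" "Y \<in> psd" and A: "hermitian_mat A"
  shows "trace ((G (L X) - G (L Y)) ** L A) = trace ((G X - G Y) ** A)"
proof -
  obtain P Q where PQ: "P \<in> pos_def" "Q \<in> pos_def" "A = P - Q" using hermitian_diff_pos_def[OF A] .
  define X' Y' where "X' k = X + inverse (real (Suc k)) *\<^sub>R mat 1"
    and "Y' k = Y + inverse (real (Suc k)) *\<^sub>R mat 1" for k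
  have pd: "X' k \<in> pos_def" "Y' k \<in> pos_def" for k
    unfolding X'_def Y'_def using X psd_plus_pos_def by blast+
  have "trace ((F (\<phi> (X' k)) - F (\<phi> (Y' k))) ** (\<phi> P - \<phi> Q)) = trace ((F (X' k) - F (Y' k)) ** (P - Q))" for k
    by (rule four_point[OF pd PQ(1,2)])
  then have eq: "trace ((G (L (X' k)) - G (L (Y' k))) ** L A) = trace ((G (X' k) - G (Y' k)) ** A)" for k
    using pd PQ by (simp add: G_eq_F phi_eq_L L_pos_def linear_diff[OF linear_L])
  have lim: "X' \<longlonglongrightarrow> X" "Y' \<longlonglongrightarrow> Y" "(\<lambda>k. L (X' k)) \<longlonglongrightarrow> L X" "(\<lambda>k. L (Y' k)) \<longlonglongrightarrow> L Y"
    unfolding X'_def Y'_def L_approx by (rule tendsto_add_scaled)+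
  have ps: "X' k \<in> psd" "Y' k \<in> psd" "L (X' k) \<in> psd" "L (Y' k) \<in> psd" for k
    using pd by (auto intro: pos_def_imp_psd L_pos_def)
  have tr: "(\<lambda>k. trace ((S k - T k) ** B)) \<longlonglongrightarrow> trace ((S0 - T0) ** B)"
    if "S \<longlonglongrightarrow> S0" "T \<longlonglongrightarrow> T0" for S T S0 T0 and B :: "complex^'n^'n"
    unfolding trace_def by (intro tendsto_intros tendsto_mm that)
  have "(\<lambda>k. trace ((G (L (X' k)) - G (L (Y' k))) ** L A)) \<longlonglongrightarrow> trace ((G (L X) - G (L Y)) ** L A)"
    by (intro tr tendsto_spectral_fun lim ps continuous_h)
  moreover have "(\<lambda>k. trace ((G (X' k) - G (Y' k)) ** A)) \<longlonglongrightarrow> trace ((G X - G Y) ** A)"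
    by (intro tr tendsto_spectral_fun lim ps continuous_h)
  ultimately show ?thesis unfolding eq by (rule LIMSEQ_unique)
qed

lemma h_gt: obtains s where "s > 0" "h s > h 0"
proof (rule ccontr)
  note witness = that
  assume a: "\<not> thesis"
  have "deriv f s \<le> h 0" if s: "s > 0" for s using a witness[OF s] s by (metis h_def not_less)
  then have "bdd_above (deriv f ` {0<..})" by (auto intro!: bdd_aboveI[of _ "h 0"])
  then show False using unbdd by simp
qed

section \<open>The inverse map and the images of rank one projections\<close>

text \<open>Supplies positivity of the inverse of \<open>L\<close>, so that \<open>L\<close>
  preserves extreme rays of the cone.\<close>

lemma inverse_preserver: "bregman_preserver f (inv_into pos_def \<phi>)"
proof
  let ?\<psi> = "inv_into pos_def \<phi>"
  show b: "bij_betw ?\<psi> pos_def pos_def" by (rule bij_betw_inv_into[OF bij])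
  show "\<forall>A\<in>pos_def. \<forall>B\<in>pos_def. bregman f (?\<psi> A) (?\<psi> B) = bregman f A B"
  proof (intro ballI)
    fix A B :: "complex^'n^'n" assume "A \<in> pos_def" "B \<in> pos_def"
    then have "?\<psi> A \<in> pos_def" "?\<psi> B \<in> pos_def" "\<phi> (?\<psi> A) = A" "\<phi> (?\<psi> B) = B"
      using bij b by (auto simp: bij_betw_def f_inv_into_f)
    then show "bregman f (?\<psi> A) (?\<psi> B) = bregman f A B" using pres by metis
  qed
qed (use convex diff bdd unbdd in auto)

interpretation inv: bregman_preserver f "inv_into pos_def \<phi>"
  by (rule inverse_preserver)

abbreviation "M \<equiv> inv.L"

lemma M_L: assumes "hermitian_mat A" shows "M (L A) = A"
proof -
  obtain P Q where PQ: "P \<in> pos_def" "Q \<in> pos_def" "A = P - Q" using hermitian_diff_pos_def[OF assms] .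
  have "inv_into pos_def \<phi> (\<phi> X) = X" if "X \<in> pos_def" for X
    using bij that by (simp add: bij_betw_def inv_into_f_f)
  then show ?thesis using PQ by (simp add: L_diff inv.L_diff phi_pos_def)
qed

lemma L_M: assumes "hermitian_mat A" shows "L (M A) = A"
proof -
  obtain P Q where PQ: "P \<in> pos_def" "Q \<in> pos_def" "A = P - Q" using hermitian_diff_pos_def[OF assms] .
  have "\<phi> (inv_into pos_def \<phi> X) = X" if "X \<in> pos_def" for X
    using bij that by (simp add: bij_betw_def f_inv_into_f)
  then show ?thesis using PQ by (simp add: L_diff inv.L_diff inv.phi_pos_def)
qed

lemma G_rank_one:
  assumes "norm v = 1" shows "G (s *\<^sub>R outer v) - G 0 = (h s - h 0) *\<^sub>R outer v"
  using spectral_fun_rank_one[OF assms, of h s] spectral_fun_rank_one[OF assms, of h 0] by simp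

text \<open>A nonzero spectral summand \<open>B\<close> of the image, pulled back by
  \<open>M\<close>, lies between \<open>0\<close> and \<open>outer v\<close>, hence is a multiple of
  \<open>outer v\<close>. So the whole image is a multiple of \<open>B\<close>.\<close>

lemma L_rank_one_multiple:
  assumes v: "norm v = 1"
  shows "\<exists>w m. norm w = 1 \<and> m > 0 \<and> L (outer v) = m *\<^sub>R outer w"
proof -
  have psdL: "L (outer v) \<in> psd" by (intro L_psd) simp
  obtain u d where u: "onb u" "L (outer v) = diag_in u d"
    using hermitian_spectral[OF hermitian_L] .
  have d: "d i \<ge> 0" for i using psdL u diag_in_psd_iff by metis
  have nz: "outer w \<noteq> 0" if "norm w = 1" for w :: "complex^'n"
  proof
    assume "outer w = 0"
    then have "outer w *v w = 0" by simp
    then show False using that by (auto simp: outer_mv cinner_self)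
  qed
  have "L (outer v) \<noteq> 0" using M_L[of "outer v"] nz[OF v] linear_0[OF inv.linear_L] by force
  then obtain i where i: "d i \<noteq> 0" unfolding u diag_in_def by (metis (no_types, lifting) scaleR_zero_left sum.neutral)
  define B where "B = d i *\<^sub>R outer (u i)"
  have Bp: "B \<in> psd" unfolding B_def by (intro psd_scale d) simp
  have "B = diag_in u (\<lambda>j. if j = i then d i else 0)"
    by (simp add: B_def diag_in_def if_distrib if_distribR cong: if_cong)
  then have "L (outer v) - B = diag_in u (\<lambda>j. if j = i then 0 else d j)"
    by (auto simp: u diag_in_diff intro!: arg_cong[of _ _ "diag_in u"])
  then have "L (outer v) - B \<in> psd" using d by (simp add: diag_in_psd_iff[OF u(1)])
  then have "M (L (outer v) - B) \<in> psd" by (rule inv.L_psd)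
  then have "outer v - M B \<in> psd" by (simp add: linear_diff[OF inv.linear_L] M_L)
  from rank_one_extreme[OF v inv.L_psd[OF Bp] this] obtain t where t: "M B = t *\<^sub>R outer v" by blast
  then have B: "B = t *\<^sub>R L (outer v)"
    using L_M[OF psd_hermitian[OF Bp]] by (simp add: linear_scale[OF linear_L])
  have nu: "norm (u i) = 1" using onb_norm[OF u(1)] .
  have "B \<noteq> 0" using i nz[OF nu] by (simp add: B_def)
  then have t0: "t \<noteq> 0" using B by auto
  define m where "m = d i / t"
  have eq: "L (outer v) = m *\<^sub>R outer (u i)"
  proof -
    have "m *\<^sub>R outer (u i) = inverse t *\<^sub>R B" by (simp add: B_def m_def divide_inverse mult.commute)
    also have "\<dots> = L (outer v)" using t0 by (subst B) simp
    finally show ?thesis ..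
  qed
  have "inner (L (outer v) *v u i) (u i) \<ge> 0" using psdL by (rule psdD)
  then have "m \<ge> 0" using nu by (simp add: eq inner_outer cinner_self)
  moreover have "m \<noteq> 0" using i t0 by (simp add: m_def)
  ultimately show ?thesis using eq nu by (intro exI[of _ "u i"] exI[of _ m]) auto
qed

text \<open>The trace identity at \<open>s *\<^sub>R outer v\<close> and \<open>0\<close> yields
  \<open>(h (s * m) - h 0) * m = h s - h 0\<close>. As \<open>h\<close> is monotone and
  \<open>h s > h 0\<close>, the left side is too small for \<open>m < 1\<close> and too large for
  \<open>m > 1\<close>.\<close>

lemma L_rank_one:
  assumes v: "norm v = 1"
  shows "\<exists>w. norm w = 1 \<and> L (outer v) = outer w"
proof -
  obtain w m where w: "norm w = 1" "m > 0" "L (outer v) = m *\<^sub>R outer w"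
    using L_rank_one_multiple[OF v] by blast
  obtain s where s: "s > 0" "h s > h 0" using h_gt .
  have tr1: "trace (outer x ** outer x) = 1" if "norm x = 1" for x :: "complex^'n"
    using that by (simp add: trace_outer outer_mv cinner_simps cinner_self)
  have "trace ((G (L (s *\<^sub>R outer v)) - G (L 0)) ** L (outer v)) = trace ((G (s *\<^sub>R outer v) - G 0) ** outer v)"
    using s by (intro trace_identity psd_scale) auto
  then have "trace (((h (s * m) - h 0) *\<^sub>R outer w) ** (m *\<^sub>R outer w)) = trace (((h s - h 0) *\<^sub>R outer v) ** outer v)"
    using G_rank_one[OF w(1), of "s * m"] G_rank_one[OF v, of s]
    by (simp add: linear_scale[OF linear_L] linear_0[OF linear_L] w)
  then have "complex_of_real ((h (s * m) - h 0) * m) = complex_of_real (h s - h 0)"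
    by (simp add: mm_scaleR trace_scaleR tr1 v w scaleR_conv_of_real[where 'a=complex] mult_ac)
  then have eq: "(h (s * m) - h 0) * m = h s - h 0" by (simp only: of_real_eq_iff)
  have "m = 1"
  proof (rule ccontr)
    assume "m \<noteq> 1"
    then consider "m < 1" | "m > 1" by linarith
    then show False
    proof cases
      case 1
      have "h (s * m) \<le> h s" using 1 w s by (intro mono_onD[OF mono_h]) (auto simp: mult_le_cancel_left1)
      then have "(h (s * m) - h 0) * m \<le> (h s - h 0) * m" using w by (intro mult_right_mono) auto
      moreover have "(h s - h 0) * m < (h s - h 0) * 1" using s 1 by (intro mult_strict_left_mono) auto
      ultimately show False using eq by simp
    next
      case 2
      have "h s \<le> h (s * m)" using 2 w s by (intro mono_onD[OF mono_h]) (auto simp: mult_le_cancel_left1)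
      then have "(h s - h 0) * m \<le> (h (s * m) - h 0) * m" using w by (intro mult_right_mono) auto
      moreover have "(h s - h 0) * 1 < (h s - h 0) * m" using s 2 by (intro mult_strict_left_mono) auto
      ultimately show False using eq by simp
    qed
  qed
  then show ?thesis using w by auto
qed

text \<open>Once projections go to projections, both sides of the trace identity carry the same
  nonzero factor \<open>h s - h 0\<close>, which cancels.\<close>

lemma L_trace:
  assumes v: "norm v = 1"
  shows "trace (L (outer v) ** L (outer x)) = trace (outer v ** outer x)"
proof -
  obtain w where w: "norm w = 1" "L (outer v) = outer w" using L_rank_one[OF v] by blast
  obtain s where s: "s > 0" "h s > h 0" using h_gt .
  have "trace ((G (L (s *\<^sub>R outer v)) - G (L 0)) ** L (outer x)) = trace ((G (s *\<^sub>R outer v) - G 0) ** outer x)"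
    using s by (intro trace_identity psd_scale) auto
  then have "trace (((h s - h 0) *\<^sub>R outer w) ** L (outer x)) = trace (((h s - h 0) *\<^sub>R outer v) ** outer x)"
    using G_rank_one[OF w(1), of s] G_rank_one[OF v, of s]
    by (simp add: linear_scale[OF linear_L] linear_0[OF linear_L] w)
  then show ?thesis using s by (simp add: mm_scaleR trace_scaleR w)
qed

end

section \<open>Wigner's theorem for linear maps\<close>

lemma onb_coeff:
  assumes "onb u" shows "cinner (\<Sum>j\<in>UNIV. a j *s u j) (u i) = a i"
proof -
  have "cinner (\<Sum>j\<in>UNIV. a j *s u j) (u i) = (\<Sum>j\<in>UNIV. if j = i then a i else 0)"
    unfolding cinner_sum_left using assms by (intro sum.cong) (auto simp: cinner_simps onb_def)
  then show ?thesis by simp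
qed

lemma onb_parseval:
  assumes "onb u" shows "cinner x y = (\<Sum>i\<in>UNIV. cinner x (u i) * cnj (cinner y (u i)))"
proof -
  have "cinner x y = cinner x (\<Sum>i\<in>UNIV. cinner y (u i) *s u i)"
    using onb_expand[OF assms, of y] by simp
  then show ?thesis by (simp add: cinner_sum_right cinner_simps mult.commute)
qed

lemma onb_entries_ext:
  assumes "onb u" "\<And>i j. cinner (A *v u j) (u i) = cinner (B *v u j) (u i)" shows "A = B"
proof (rule onb_ext[OF assms(1)])
  fix j show "A *v u j = B *v u j"
    using onb_expand[OF assms(1), of "A *v u j"] onb_expand[OF assms(1), of "B *v u j"] assms(2) by simp
qed

lemma cinner_outer_entry: "cinner (outer v *v x) y = cinner v y * cnj (cinner v x)"
  by (simp add: outer_mv cinner_simps mult.commute cinner_commute[of x v])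

text \<open>Applied with \<open>a\<close> and \<open>b\<close> on the axes \<open>i\<close> and
  \<open>j\<close> and \<open>c\<close> zero there: every term of the last group misses coordinate
  \<open>i\<close> or \<open>j\<close>, so only \<open>outer (a + b)\<close> affects the entry
  \<open>m _ i j\<close>.\<close>

lemma outer_locality:
  "outer (a + b + c) = outer (a + b) + (outer (a + c) + outer (b + c) - outer a - outer b - outer c)"
  by (simp add: outer_def vec_eq_iff algebra_simps)

text \<open>The correction terms are diagonal, so off the diagonal only the product
  \<open>x * cnj y\<close> matters.\<close>

lemma outer_two_axes:
  assumes "i \<noteq> j"
  shows "outer (axis i x + axis j y) = outer (axis i (x * cnj y) + axis j 1)
    + (outer (axis i x) - outer (axis i (x * cnj y)) + outer (axis j y) - outer (axis j 1))"
  using assms by (simp add: outer_def vec_eq_iff axis_def)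

text \<open>Modulo diagonal matrices the left side is real affine in \<open>z\<close> with no
  constant term; this gives the real linearity of \<open>lam i j\<close>.\<close>

lemma outer_two_axes_linear:
  assumes "i \<noteq> j"
  shows "outer (axis i z + axis j 1) = Re z *\<^sub>R outer (axis i 1 + axis j 1) + Im z *\<^sub>R outer (axis i \<i> + axis j 1)
    + ((1 - Re z - Im z) *\<^sub>R outer (axis j 1) + outer (axis i z) - (Re z + Im z) *\<^sub>R outer (axis i 1))"
  using assms by (auto simp: outer_def vec_eq_iff axis_def complex_eq_iff algebra_simps)

text \<open>The quotient \<open>q\<close> of \<open>b\<close> by \<open>a\<close> has modulus 1, and
  \<open>1 + q\<close> has modulus \<open>sqrt 2\<close>, which forces
  \<open>Re q = 0\<close>.\<close>

lemma complex_real_isometry: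
  fixes a b :: complex
  assumes "\<And>x y. norm (x *\<^sub>R a + y *\<^sub>R b) = norm (Complex x y)"
  shows "b = \<i> * a \<or> b = - \<i> * a"
proof -
  have a: "norm a = 1" using assms[of 1 0] by (simp add: complex_norm)
  have b: "norm b = 1" using assms[of 0 1] by (simp add: complex_norm)
  have ab: "norm (a + b) = sqrt 2" using assms[of 1 1] by (simp add: complex_norm)
  define q where "q = b * cnj a"
  have aa: "a * cnj a = 1" using complex_norm_square[of a] a by simp
  then have bq: "b = q * a" by (simp add: q_def mult.assoc mult.commute[of "cnj a"])
  have q: "(Re q)\<^sup>2 + (Im q)\<^sup>2 = 1" 
    using a b cmod_power2[of q] by (simp add: q_def norm_mult)
  have "a + b = a * (1 + q)" using bq by (simp add: algebra_simps)
  then have "norm (1 + q) = sqrt 2" using ab a by (simp add: norm_mult)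
  then have "(1 + Re q)\<^sup>2 + (Im q)\<^sup>2 = 2" using cmod_power2[of "1 + q"] by simp
  then have "Re q = 0" using q by (simp add: power2_eq_square algebra_simps)
  then have "Im q = 1 \<or> Im q = -1" using q by (simp add: power2_eq_1_iff)
  then have "q = \<i> \<or> q = - \<i>" using \<open>Re q = 0\<close> by (auto simp: complex_eq_iff)
  then show ?thesis using bq by auto
qed

text \<open>Since \<open>\<sigma>\<close> is a ring homomorphism commuting with conjugation and the
  phases cancel, \<open>U\<close> transforms inner products by \<open>\<sigma>\<close>. This gives
  injectivity, and finite dimension gives surjectivity.\<close>

lemma unitary_or_antiunitary:
  fixes u :: "'n \<Rightarrow> complex^'n" and c :: "'n \<Rightarrow> complex" and \<sigma> :: "complex \<Rightarrow> complex"
  assumes u: "onb u" and c: "\<And>i. c i * cnj (c i) = 1" and \<sigma>: "\<sigma> = id \<or> \<sigma> = cnj"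
  defines "U \<equiv> \<lambda>v. \<Sum>i\<in>UNIV. (cnj (c i) * \<sigma> (v $ i)) *s u i"
  shows "unitary_op U \<or> antiunitary_op U"
proof -
  have Ui: "cinner (U v) (u i) = cnj (c i) * \<sigma> (v $ i)" for v i
    unfolding U_def by (rule onb_coeff[OF u])
  have hom: "\<sigma> (x * y) = \<sigma> x * \<sigma> y" "\<sigma> (x + y) = \<sigma> x + \<sigma> y" "\<sigma> (cnj x) = cnj (\<sigma> x)"
    "\<sigma> (sum h I) = (\<Sum>i\<in>I. \<sigma> (h i))" "\<sigma> (of_real r) = of_real r" for x y r h and I :: "'n set"
    using \<sigma> by auto
  have inner: "cinner (U v) (U w) = \<sigma> (cinner v w)" for v w
  proof -
    have "cinner (U v) (U w) = (\<Sum>i\<in>UNIV. (c i * cnj (c i)) * (\<sigma> (v $ i) * cnj (\<sigma> (w $ i))))"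
      by (simp add: onb_parseval[OF u, of "U v"] Ui mult_ac)
    then show ?thesis by (simp add: c cinner_def hom)
  qed
  have add: "U (x + y) = U x + U y" for x y
    by (simp add: U_def hom distrib_left sum.distrib vec.scale_left_distrib)
  have scale: "U (a *s x) = \<sigma> a *s U x" for a x
    by (simp add: U_def hom vec_eq_iff sum_distrib_left mult_ac)
  have lin: "linear U"
  proof (rule linearI[OF add])
    have "U (of_real r *s x) = of_real r *s U x" for r x by (simp add: scale hom)
    then show "U (r *\<^sub>R x) = r *\<^sub>R U x" for r x
      by (simp add: vec_eq_iff scaleR_conv_of_real[where 'a=complex] vector_scalar_mult_def scaleR_vec_def)
  qed
  have "inj U"
  proof (subst linear_injective_0[OF lin], intro allI impI)
    fix x assume "U x = 0"
    then have "\<sigma> (cinner x x) = 0" using inner[of x x] by (simp add: cinner_simps)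
    then have "cinner x x = 0" using \<sigma> by auto
    then show "x = 0" by simp
  qed
  then have bij: "bij U" using linear_injective_imp_surjective[OF lin] by (simp add: bij_def)
  show ?thesis
    using \<sigma>
  proof
    assume s: "\<sigma> = id"
    then have "Vector_Spaces.linear (*s) (*s) U"
      by (simp add: Vector_Spaces.linear_iff add scale vec.vector_space_axioms)
    then show ?thesis using bij inner s by (simp add: unitary_op_def)
  next
    assume s: "\<sigma> = cnj"
    then have "conj_linear U" by (simp add: conj_linear_def add scale)
    moreover have "cinner (U x) (U y) = cinner y x" for x y
      using inner[of x y] s cinner_commute[of y x] by simp
    ultimately show ?thesis using bij by (simp add: antiunitary_op_def)
  qed
qed

text \<open>
  In the basis \<open>u\<close> of images of the standard basis, the \<open>(i, j)\<close> entry of \<open>L (v v\<^sup>*)\<close> is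
  \<open>lam i j (v\<^sub>i cnj v\<^sub>j)\<close> with a real linear isometry \<open>lam i j\<close> of the complex plane, and rank one
  forces \<open>lam i j x * lam j k y = lam i k (x * y)\<close>; so \<open>lam i j\<close> is the identity or the conjugation,
  with the same choice for all \<open>i\<close> and \<open>j\<close>, up to the phase \<open>cnj (c i) * c j\<close>.
\<close>

theorem linear_wigner:
  fixes L :: "complex^'n^'n \<Rightarrow> complex^'n^'n"
  assumes lin: "linear L"
    and rank_one: "\<And>v. norm v = 1 \<Longrightarrow> \<exists>w. norm w = 1 \<and> L (outer v) = outer w"
    and tr: "\<And>v x. norm v = 1 \<Longrightarrow> trace (L (outer v) ** L (outer x)) = trace (outer v ** outer x)"
  shows "\<exists>U. (unitary_op U \<or> antiunitary_op U) \<and> (\<forall>v. L (outer v) = outer (U v))"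
proof -
  have "\<exists>w. L (outer v) = outer w" for v
  proof (cases "v = 0")
    case True
    have "outer 0 = (0 :: complex^'n^'n)" by (simp add: outer_def vec_eq_iff)
    then show ?thesis using True linear_0[OF lin] by metis
  next
    case False
    define v' where "v' = (1 / norm v) *\<^sub>R v"
    have "norm v' = 1" "v = norm v *\<^sub>R v'" using False by (auto simp: v'_def)
    then show ?thesis using rank_one[of v'] by (metis linear_scale[OF lin] outer_scaleR)
  qed
  then obtain W where W: "\<And>v. L (outer v) = outer (W v)" by metis
  have tr_outer: "trace (outer x ** outer y) = of_real ((norm (cinner x y))\<^sup>2)" for x y :: "complex^'n"
    by (simp add: trace_outer cinner_outer_entry cinner_commute[of y x] mult.commute
        complex_norm_square[symmetric] del: of_real_power)
  have W_inner: "norm (cinner (W v) (W x)) = norm (cinner v x)" if "norm v = 1" for v x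
    using tr[OF that, of x] unfolding W tr_outer by (simp only: of_real_eq_iff power2_eq_iff_nonneg norm_ge_zero)
  define e :: "'n \<Rightarrow> complex^'n" where "e i = axis i 1" for i
  have e: "norm (e i) = 1" for i by (simp add: e_def norm_axis_1)
  define u where "u i = W (e i)" for i
  have u: "onb u"
    unfolding onb_def
  proof (intro allI)
    fix i j
    have n: "norm (cinner (u i) (u j)) = (if i = j then 1 else 0)"
      unfolding u_def W_inner[OF e] by (simp add: e_def) (simp add: axis_def)
    show "cinner (u i) (u j) = (if i = j then 1 else 0)"
    proof (cases "i = j")
      case True
      then show ?thesis using n by (simp add: cinner_self del: of_real_power)
    qed (use n in auto)
  qed
  define N where "N A i j = cinner (A *v u j) (u i)" for A i j
  have N_lin: "N (A + B) i j = N A i j + N B i j" "N (A - B) i j = N A i j - N B i j"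
    "N (r *\<^sub>R A) i j = r *\<^sub>R N A i j" for A B r i j
    by (simp_all add: N_def matrix_vector_mult_add_rdistrib matrix_vector_mult_diff_rdistrib cinner_simps)
  define m where "m A i j = N (L A) i j" for A i j
  have m_lin: "m (A + B) i j = m A i j + m B i j" "m (A - B) i j = m A i j - m B i j"
    "m (r *\<^sub>R A) i j = r *\<^sub>R m A i j" for A B r i j
    by (simp_all add: m_def linear_add[OF lin] linear_diff[OF lin] linear_scale[OF lin] N_lin)
  define w where "w v i = cinner (W v) (u i)" for v i
  have m_outer: "m (outer v) i j = w v i * cnj (w v j)" for v i j
    by (simp add: m_def N_def W w_def cinner_outer_entry)
  have w_norm: "norm (w v i) = norm (v $ i)" for v i
  proof -
    have "norm (w v i) = norm (cinner (W (e i)) (W v))"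
      unfolding w_def u_def by (subst cinner_commute) (simp only: complex_mod_cnj)
    also have "\<dots> = norm (v $ i)" unfolding W_inner[OF e] by (simp add: e_def)
    finally show ?thesis .
  qed
  have m_zero: "m (outer v) i j = 0" if "v $ i = 0 \<or> v $ j = 0" for v i j
    using that w_norm[of v i] w_norm[of v j] by (auto simp: m_outer)
  have m_diag: "m (outer v) i i = v $ i * cnj (v $ i)" for v i
    by (simp add: m_outer complex_norm_square[symmetric] w_norm del: of_real_power)
  define lam where "lam i j z = m (outer (axis i z + axis j 1)) i j" for i j z
  have m_lam: "m (outer v) i j = lam i j (v $ i * cnj (v $ j))" if "i \<noteq> j" for v i j
  proof -
    define a b c where "a = axis i (v $ i)" and "b = axis j (v $ j)" and "c = v - a - b"
    have v: "v = a + b + c" by (simp add: c_def)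
    have "m (outer v) i j = m (outer (a + b)) i j"
      unfolding v outer_locality
      using that by (simp add: m_lin m_zero a_def b_def c_def axis_def)
    also have "\<dots> = lam i j (v $ i * cnj (v $ j))"
      unfolding a_def b_def lam_def
      by (subst outer_two_axes[OF that]) (use that in \<open>simp add: m_lin m_zero axis_def\<close>)
    finally show ?thesis .
  qed
  have lam_lin: "lam i j z = Re z *\<^sub>R lam i j 1 + Im z *\<^sub>R lam i j \<i>" if "i \<noteq> j" for i j z
    unfolding lam_def outer_two_axes_linear[OF that, of z]
    using that by (simp add: m_lin m_zero axis_def)
  have lam_norm: "norm (lam i j z) = norm z" if "i \<noteq> j" for i j z
    unfolding lam_def m_outer using that by (simp add: norm_mult w_norm) (simp add: axis_def)
  have lam_cases: "lam i j \<i> = \<i> * lam i j 1 \<or> lam i j \<i> = - \<i> * lam i j 1" if "i \<noteq> j" for i j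
  proof (rule complex_real_isometry)
    fix x y
    show "norm (x *\<^sub>R lam i j 1 + y *\<^sub>R lam i j \<i>) = norm (Complex x y)"
      using lam_lin[OF that, of "Complex x y"] lam_norm[OF that, of "Complex x y"] by simp
  qed
  have lam_mult: "lam i j x * lam j k y = lam i k (x * y)" if "i \<noteq> j" "j \<noteq> k" "i \<noteq> k" for i j k x y
  proof -
    \<comment> \<open>The middle coordinate \<open>1\<close> makes \<open>m (outer v) j j\<close>
      equal to 1; \<open>y\<close> is conjugated because \<open>lam j k\<close> is evaluated at
      \<open>v $ j * cnj (v $ k)\<close>.\<close>
    define v where "v = axis i x + axis j 1 + axis k (cnj y)"
    have v: "v $ i = x" "v $ j = 1" "v $ k = cnj y" using that by (auto simp: v_def axis_def)
    have "m (outer v) i j * m (outer v) j k = m (outer v) i k * m (outer v) j j"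
      by (simp add: m_outer mult_ac)
    then show ?thesis using that by (simp add: m_lam m_diag v)
  qed
  have lam_cnj: "lam j i z = cnj (lam i j (cnj z))" if "i \<noteq> j" for i j z
  proof -
    define v where "v = axis i (cnj z) + axis j 1"
    have v: "v $ i = cnj z" "v $ j = 1" using that by (auto simp: v_def axis_def)
    have "m (outer v) j i = cnj (m (outer v) i j)" by (simp add: m_outer mult_ac)
    then show ?thesis using that by (simp add: m_lam v)
  qed
  \<comment> \<open>A reference index, from whose row the phases \<open>c\<close> and the choice of
    \<open>\<sigma>\<close> are read off.\<close>
  obtain o1 :: 'n where True by blast
  define c where "c j = (if j = o1 then 1 else lam o1 j 1)" for j
  have c_o: "c o1 = 1" by (simp add: c_def)
  have c_norm: "norm (c j) = 1" for j using lam_norm[of o1 j 1] by (auto simp: c_def)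
  have c1: "c j * cnj (c j) = 1" for j using complex_norm_square[of "c j"] c_norm by simp
  have c0: "c j \<noteq> 0" for j using c_norm[of j] by auto
  \<comment> \<open>Factoring \<open>lam k j \<i>\<close> through \<open>o1\<close> in two ways
    transfers the choice from \<open>k\<close> to \<open>j\<close>.\<close>
  have consistent: "lam o1 j \<i> = \<i> * c j" if "k \<noteq> o1" "j \<noteq> o1" "lam o1 k \<i> = \<i> * c k" for j k
  proof (cases "j = k")
    case False
    have "lam k o1 \<i> * lam o1 j 1 = lam k o1 1 * lam o1 j \<i>"
      using lam_mult[of k o1 j \<i> 1] lam_mult[of k o1 j 1 \<i>] that False by simp
    moreover have "lam k o1 1 = cnj (c k)" using lam_cnj[of o1 k 1] that by (simp add: c_def)
    moreover have "lam k o1 \<i> = \<i> * cnj (c k)"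
      using lam_cnj[of o1 k \<i>] lam_lin[of o1 k "- \<i>"] that by simp
    ultimately have "cnj (c k) * (\<i> * c j) = cnj (c k) * lam o1 j \<i>" using that by (simp add: c_def)
    then show ?thesis using c0[of k] by simp
  qed (use that in simp)
  have "\<exists>\<sigma>. (\<sigma> = id \<or> \<sigma> = cnj) \<and> (\<forall>j z. j \<noteq> o1 \<longrightarrow> lam o1 j z = c j * \<sigma> z)"
  proof (cases "\<exists>k. k \<noteq> o1 \<and> lam o1 k \<i> = \<i> * c k")
    case True
    have "lam o1 j z = c j * id z" if "j \<noteq> o1" for j z
    proof -
      have 1: "lam o1 j \<i> = \<i> * c j" using True consistent[OF _ that] by blast
      have 2: "lam o1 j 1 = c j" using that by (simp add: c_def)
      have "lam o1 j z = Re z *\<^sub>R c j + Im z *\<^sub>R (\<i> * c j)"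
        using lam_lin[of o1 j z] that unfolding 1 2 by simp
      then show ?thesis by (simp add: complex_eq_iff algebra_simps)
    qed
    then show ?thesis by blast
  next
    \<comment> \<open>In dimension one this branch is taken, and the claim about \<open>lam\<close>
      is vacuous.\<close>
    case False
    have "lam o1 j z = c j * cnj z" if "j \<noteq> o1" for j z
    proof -
      have 2: "lam o1 j 1 = c j" using that by (simp add: c_def)
      have 1: "lam o1 j \<i> = - \<i> * c j" using False lam_cases[of o1 j] that 2 by auto
      have "lam o1 j z = Re z *\<^sub>R c j + Im z *\<^sub>R (- \<i> * c j)"
        using lam_lin[of o1 j z] that unfolding 1 2 by simp
      then show ?thesis by (simp add: complex_eq_iff algebra_simps)
    qed
    then show ?thesis by blast
  qed
  then obtain \<sigma> where \<sigma>: "\<sigma> = id \<or> \<sigma> = cnj" and lam_o: "\<And>j z. j \<noteq> o1 \<Longrightarrow> lam o1 j z = c j * \<sigma> z"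
    by blast
  have \<sigma>_mult: "\<sigma> (x * cnj y) = \<sigma> x * cnj (\<sigma> y)" "\<sigma> (cnj x) = cnj (\<sigma> x)" "\<sigma> 1 = 1"
    "\<sigma> x * cnj (\<sigma> x) = x * cnj x" for x y
    using \<sigma> by auto
  have lam_to_o: "lam j o1 z = cnj (c j) * \<sigma> z" if "j \<noteq> o1" for j z
    using lam_cnj[of o1 j z] lam_o[OF that, of "cnj z"] that by (simp add: \<sigma>_mult)
  have m_\<sigma>: "m (outer v) i j = (cnj (c i) * \<sigma> (v $ i)) * cnj (cnj (c j) * \<sigma> (v $ j))" for v i j
  proof (cases "i = j")
    case True
    have "(cnj (c i) * \<sigma> (v $ i)) * cnj (cnj (c i) * \<sigma> (v $ i)) =
        (c i * cnj (c i)) * (\<sigma> (v $ i) * cnj (\<sigma> (v $ i)))" by (simp add: mult_ac)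
    then show ?thesis using True by (simp add: c1 \<sigma>_mult m_diag)
  next
    case ij: False
    have "lam i j z = cnj (c i) * c j * \<sigma> z" for z
    proof (cases "i = o1 \<or> j = o1")
      case True
      then show ?thesis using lam_o lam_to_o ij c_o by auto
    next
      case False
      then have "lam i j z = lam i o1 1 * lam o1 j z" using lam_mult[of i o1 j 1 z] ij by force
      then show ?thesis using False by (simp add: lam_o lam_to_o \<sigma>_mult)
    qed
    then show ?thesis by (simp add: m_lam[OF ij] \<sigma>_mult mult_ac)
  qed
  define U where "U v = (\<Sum>i\<in>UNIV. (cnj (c i) * \<sigma> (v $ i)) *s u i)" for v :: "complex^'n"
  have Ui: "cinner (U v) (u i) = cnj (c i) * \<sigma> (v $ i)" for v i
    unfolding U_def by (rule onb_coeff[OF u])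
  have "L (outer v) = outer (U v)" for v
  proof (rule onb_entries_ext[OF u])
    fix i j
    have "cinner (L (outer v) *v u j) (u i) = m (outer v) i j" by (simp add: m_def N_def)
    then show "cinner (L (outer v) *v u j) (u i) = cinner (outer (U v) *v u j) (u i)"
      by (simp only: m_\<sigma> cinner_outer_entry Ui)
  qed
  moreover have "unitary_op U \<or> antiunitary_op U"
    using unitary_or_antiunitary[OF u c1 \<sigma>] unfolding U_def[abs_def] .
  ultimately show ?thesis by blast
qed

section \<open>Adjoints as inverses, and the conclusion\<close>

lemma cinner_ext: "(\<And>x. cinner x y = cinner x z) \<Longrightarrow> y = z"
  by (metis cinner_eq_zero_iff cinner_simps(4) eq_iff_diff_eq_0)

text \<open>Preservation of the inner product makes \<open>inv U\<close> meet the description, and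
  nondegeneracy excludes other candidates.\<close>

lemma op_adj_unitary:
  assumes "unitary_op U" shows "op_adj U = inv U"
  unfolding op_adj_def
proof (rule the_equality)
  have b: "bij U" and l: "Vector_Spaces.linear (*s) (*s) U" and c: "\<And>x y. cinner (U x) (U y) = cinner x y"
    using assms by (auto simp: unitary_op_def)
  have U: "U (inv U y) = y" "inv U (U y) = y" for y
    using b by (simp_all add: bij_def surj_f_inv_f)
  have hom: "U (x + y) = U x + U y" "U (a *s x) = a *s U x" for x y a
    using l by (simp_all add: Vector_Spaces.linear_iff)
  have "inv U (x + y) = inv U x + inv U y" "inv U (a *s x) = a *s inv U x" for x y a
    using U hom by metis+
  then have "Vector_Spaces.linear (*s) (*s) (inv U)"
    by (simp add: Vector_Spaces.linear_iff vec.vector_space_axioms)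
  moreover have adj: "cinner (U x) y = cinner x (inv U y)" for x y using c U by metis
  ultimately show "Vector_Spaces.linear (*s) (*s) (inv U) \<and> (\<forall>x y. cinner (U x) y = cinner x (inv U y))"
    by blast
  fix V assume "Vector_Spaces.linear (*s) (*s) V \<and> (\<forall>x y. cinner (U x) y = cinner x (V y))"
  then show "V = inv U" using adj by (intro ext cinner_ext) metis
qed

lemma conj_op_adj_antiunitary:
  assumes "antiunitary_op U" shows "conj_op_adj U = inv U"
  unfolding conj_op_adj_def
proof (rule the_equality)
  have b: "bij U" and l: "conj_linear U" and c: "\<And>x y. cinner (U x) (U y) = cinner y x"
    using assms by (auto simp: antiunitary_op_def)
  have U: "U (inv U y) = y" "inv U (U y) = y" for y
    using b by (simp_all add: bij_def surj_f_inv_f)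
  have hom: "U (x + y) = U x + U y" "U (a *s x) = cnj a *s U x" for x y a
    using l by (simp_all add: conj_linear_def)
  have "inv U (x + y) = inv U x + inv U y" "inv U (a *s x) = cnj a *s inv U x" for x y a
    using U hom complex_cnj_cnj by metis+
  then have "conj_linear (inv U)" by (simp add: conj_linear_def)
  moreover have adj: "cinner (U x) y = cinner (inv U y) x" for x y using c U by metis
  ultimately show "conj_linear (inv U) \<and> (\<forall>x y. cinner (U x) y = cinner (inv U y) x)"
    by blast
  fix V assume "conj_linear V \<and> (\<forall>x y. cinner (U x) y = cinner (V y) x)"
  then have "cinner x (V y) = cinner x (inv U y)" for x y
    using adj cinner_commute by metis
  then show "V = inv U" by (intro ext cinner_ext)
qed

theorem theorem3:
  fixes f :: "real \<Rightarrow> real"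
    and \<phi> :: "complex^'n^'n \<Rightarrow> complex^'n^'n"
  assumes "convex_on {0<..} f"
    and "\<forall>x>0. f differentiable at x"
    and "bdd_below (deriv f ` {0<..})"
    and "\<not> bdd_above (deriv f ` {0<..})"
    and "bij_betw \<phi> pos_def pos_def"
    and "\<forall>A\<in>pos_def. \<forall>B\<in>pos_def. bregman f (\<phi> A) (\<phi> B) = bregman f A B"
  shows "\<exists>U :: complex^'n \<Rightarrow> complex^'n.
    (unitary_op U \<and> (\<forall>A\<in>pos_def. (*v) (\<phi> A) = U \<circ> (*v) A \<circ> op_adj U)) \<or>
    (antiunitary_op U \<and> (\<forall>A\<in>pos_def. (*v) (\<phi> A) = U \<circ> (*v) A \<circ> conj_op_adj U))"
proof -
  interpret bregman_preserver f \<phi> by unfold_locales (fact assms)+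
  obtain U where U: "unitary_op U \<or> antiunitary_op U" and LU: "\<And>v. L (outer v) = outer (U v)"
    using linear_wigner[OF linear_L L_rank_one L_trace] by blast
  have bij: "bij U" using U by (auto simp: unitary_op_def antiunitary_op_def)
  have add: "U (x + y) = U x + U y" for x y
    using U by (auto simp: unitary_op_def antiunitary_op_def Vector_Spaces.linear_iff conj_linear_def)
  \<comment> \<open>In the antiunitary case the swapped inner product is exactly the conjugated
    scalar.\<close>
  have coeff: "cinner (U x) (U v) *s U v = U (cinner x v *s v)" for x v
    using U cinner_commute[of x v]
    by (auto simp: unitary_op_def antiunitary_op_def Vector_Spaces.linear_iff conj_linear_def)
  have real: "U (r *\<^sub>R x) = r *\<^sub>R U x" for r x
  proof -
    have "y = complex_of_real r *s z \<longleftrightarrow> y = r *\<^sub>R z" for y z :: "complex^'n"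
      by (simp add: vec_eq_iff scaleR_conv_of_real[where 'a=complex])
    moreover have "U (complex_of_real r *s x) = complex_of_real r *s U x"
      using U by (auto simp: unitary_op_def antiunitary_op_def Vector_Spaces.linear_iff conj_linear_def)
    ultimately show ?thesis by metis
  qed
  have lin: "linear U" by (rule linearI[OF add real])
  \<comment> \<open>An intertwining relation treats unitary and antiunitary \<open>U\<close> alike;
    the spectral decomposition of \<open>A\<close> reduces it to projections.\<close>
  have intertwine: "\<phi> A *v U x = U (A *v x)" if pd: "A \<in> pos_def" for A x
  proof -
    obtain u d where u: "onb u" "A = diag_in u d" using hermitian_spectral[OF pos_def_hermitian[OF pd]] .
    have "\<phi> A = (\<Sum>i\<in>UNIV. d i *\<^sub>R outer (U (u i)))"
      unfolding phi_eq_L[OF pd] unfolding u(2) diag_in_def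
      by (simp add: linear_sum[OF linear_L] linear_scale[OF linear_L] LU)
    then show ?thesis
      by (simp add: sum_mv outer_mv coeff u diag_in_def linear_sum[OF lin] real)
  qed
  have "(*v) (\<phi> A) = U \<circ> (*v) A \<circ> inv U" if "A \<in> pos_def" for A
  proof
    fix y
    have "U (inv U y) = y" using bij by (simp add: bij_def surj_f_inv_f)
    then show "\<phi> A *v y = (U \<circ> (*v) A \<circ> inv U) y"
      using intertwine[OF that, of "inv U y"] by simp
  qed
  then show ?thesis using U op_adj_unitary conj_op_adj_antiunitary by metis
qed

end
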